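(* Let $F:T^{1,0}M\to[0,+\infty)$ be a strongly convex complex Finsler metric on a complex manifold $M$, let $\nabla$ be the Cartan connection associated to $F$, and let $\mathbf J$ be the canonical complex structure on the complex manifold $T^{1,0}M$. If $\nabla\mathbf J=0$ and $F$ has constant holomorphic sectional curvature $c\neq0$, then $F$ is necessarily a Kähler-Einstein metric on $M$.
   Context: Standing conventions. $M$ is a complex manifold of complex dimension $n\ge 2$ with canonical complex structure $J$ on the real tangent bundle $T_{\mathbb R}M$. Greek indices run over $1,\dots,n$, Latin indices over $1,\dots,2n$, $\alpha^*=\alpha+n$, and repeated indices are summed. Local holomorphic coordinates are $z^\alpha=x^\alpha+ix^{\alpha^*}$, with fiber coordinates $v=v^\alpha\frac{\partial}{\partial z^\alpha}\in T^{1,0}M$, $v^\alpha=y^\alpha+iy^{\alpha^*}$. $T_{\mathbb R}M$ and $T^{1,0}M$ are identified by $y=y^j\frac{\partial}{\partial x^j}\mapsto y_o=\frac12(y-iJy)=v$. $\tilde M$ denotes $T^{1,0}M\setminus\{0\}\cong T_{\mathbb R}M\setminus\{0\}$; $\mathbf J\frac{\partial}{\partial x^\alpha}=\frac{\partial}{\partial x^{\alpha^*}}$, $\mathbf J\frac{\partial}{\partial x^{\alpha^*}}=-\frac{\partial}{\partial x^\alpha}$, $\mathbf J\frac{\partial}{\partial y^\alpha}=\frac{\partial}{\partial y^{\alpha^*}}$, $\mathbf J\frac{\partial}{\partial y^{\alpha^*}}=-\frac{\partial}{\partial y^\alpha}$. A strongly convex complex Finsler metric is a function $F:T^{1,0}M\to[0,+\infty)$,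 positive and $C^\infty$ on $\tilde M$, with $F(z;\lambda v)=|\lambda|F(z;v)$ for $\lambda\in\mathbb C$, such that, viewing $F$ as a function of $(x;y)$, the matrix $g_{jk}=\frac12\frac{\partial^2F^2}{\partial y^j\partial y^k}$ is positive definite on $\tilde M$ (then $G_{\alpha\bar\beta}=\frac{\partial^2F^2}{\partial v^\alpha\partial\bar v^\beta}$ is Hermitian positive definite). Write $G=F^2$, $G_\alpha=\frac{\partial F^2}{\partial v^\alpha}$. Cartan connection. $\hat{\mathbb G}^k=\frac14g^{kl}\big(\frac{\partial^2F^2}{\partial x^a\partial y^l}y^a-\frac{\partial F^2}{\partial x^l}\big)$, $\hat\Gamma^k_j=\frac{\partial\hat{\mathbb G}^k}{\partial y^j}$, $\frac{\delta}{\delta x^j}=\frac{\partial}{\partial x^j}-\hat\Gamma^k_j\frac{\partial}{\partial y^k}$; $\mathcal H_{\mathbb R}=\mathrm{span}\{\frac{\delta}{\delta x^j}\}$, $\mathcal V_{\mathbb R}=\mathrm{span}\{\frac{\partial}{\partial y^j}\}$. With $\hat\Gamma^k_{j;l}=\frac{g^{ks}}2\big(\frac{\delta g_{sj}}{\delta x^l}-\frac{\delta g_{jl}}{\delta x^s}+\frac{\delta g_{ls}}{\delta x^j}\big)$ and $\hat\Gamma^k_{jl}=\frac14g^{ks}\frac{\partial^3F^2}{\partial y^j\partial y^l\partial y^s}$, the Cartan connection $\nabla$ is the linear connection on $\mathcal V_{\mathbb R}\to\tilde M$ with $\nabla_{\frac{\delta}{\delta x^l}}\frac{\partial}{\partial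 y^j}=\hat\Gamma^k_{j;l}\frac{\partial}{\partial y^k}$, $\nabla_{\frac{\partial}{\partial y^l}}\frac{\partial}{\partial y^j}=\hat\Gamma^k_{jl}\frac{\partial}{\partial y^k}$. $\nabla\mathbf J=0$ means $\nabla_X(\mathbf JY)=\mathbf J(\nabla_XY)$ for all $X\in T_{\mathbb R}\tilde M$ and all sections $Y$ of $\mathcal V_{\mathbb R}$. Holomorphic sectional curvature. With $G^{\bar\tau\alpha}G_{\beta\bar\tau}=\delta^\alpha_\beta$, $\Gamma^\alpha_{;\mu}=G^{\bar\tau\alpha}\frac{\partial^2F^2}{\partial z^\mu\partial\bar v^\tau}$ and $\delta_\mu=\frac{\partial}{\partial z^\mu}-\Gamma^\alpha_{;\mu}\frac{\partial}{\partial v^\alpha}$, $\delta_{\bar\nu}=\overline{\delta_\nu}$, $F$ has constant holomorphic sectional curvature $c\in\mathbb R$ if $-2G_\alpha\,\delta_{\bar\nu}(\Gamma^\alpha_{;\mu})\,v^\mu\overline{v^\nu}=c\,G^2$ on $\tilde M$. $F$ is a Kähler-Einstein metric if $F^2=G_{\mu\bar\nu}(z)v^\mu\overline{v^\nu}$ with $G_{\mu\bar\nu}$ independent of $v$, and the Hermitian metric $(G_{\mu\bar\nu}(z))$ is Kähler with Ricci tensor a constant multiple of $G_{\mu\bar\nu}$. *)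

theory Defs
  imports "HOL-Analysis.Analysis"
begin

section \<open>Smooth functions and partial derivatives\<close>

primrec C_k_on :: "nat \<Rightarrow> 'a::real_normed_vector set \<Rightarrow> ('a \<Rightarrow> 'b::real_normed_vector) \<Rightarrow> bool" where
  "C_k_on 0 S f \<longleftrightarrow> continuous_on S f"
| "C_k_on (Suc k) S f \<longleftrightarrow>
     (\<forall>x\<in>S. f differentiable (at x)) \<and>
     (\<forall>u. C_k_on k S (\<lambda>x. frechet_derivative f (at x) u))"

text \<open>Only used for open \<open>S\<close>.\<close>

definition smooth_on :: "'a::real_normed_vector set \<Rightarrow> ('a \<Rightarrow> 'b::real_normed_vector) \<Rightarrow> bool" where
  "smooth_on S f \<longleftrightarrow> (\<forall>k. C_k_on k S f)"

definition holomorphic_map_on :: "(complex^'n) set \<Rightarrow> (complex^'n \<Rightarrow> complex^'n) \<Rightarrow> bool" where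
  "holomorphic_map_on S f \<longleftrightarrow>
     (\<forall>z\<in>S. \<exists>f'. (f has_derivative f') (at z) \<and> Vector_Spaces.linear (*s) (*s) f')"

definition wirtinger :: "'a::real_normed_vector \<Rightarrow> 'a \<Rightarrow> ('a \<Rightarrow> complex) \<Rightarrow> 'a \<Rightarrow> complex" where
  "wirtinger u u' f p =
     (frechet_derivative f (at p) u - \<i> * frechet_derivative f (at p) u') / 2"

definition wirtinger_bar :: "'a::real_normed_vector \<Rightarrow> 'a \<Rightarrow> ('a \<Rightarrow> complex) \<Rightarrow> 'a \<Rightarrow> complex" where
  "wirtinger_bar u u' f p =
     (frechet_derivative f (at p) u + \<i> * frechet_derivative f (at p) u') / 2"


section \<open>Complex manifolds and the holomorphic tangent bundle\<close>

text \<open>A chart is a pair of its domain and its coordinate map; values of the coordinate map outside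
  the domain are irrelevant.  The atlas need not be maximal.\<close>

type_synonym ('a, 'n) chart = "'a set \<times> ('a \<Rightarrow> complex^'n)"

definition chart_inv :: "('a, 'n) chart \<Rightarrow> complex^'n \<Rightarrow> 'a" where
  "chart_inv c = inv_into (fst c) (snd c)"

definition transition :: "('a, 'n) chart \<Rightarrow> ('a, 'n) chart \<Rightarrow> complex^'n \<Rightarrow> complex^'n" where
  "transition c d = snd d \<circ> chart_inv c"

definition complex_manifold :: "'a topology \<Rightarrow> ('a, 'n::finite) chart set \<Rightarrow> bool" where
  "complex_manifold M A \<longleftrightarrow>
     Hausdorff_space M \<and> second_countable M \<and>
     topspace M = \<Union> (fst ` A) \<and>
     (\<forall>(U, \<phi>)\<in>A. openin M U \<and> open (\<phi> ` U) \<and>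
        homeomorphic_map (subtopology M U) (top_of_set (\<phi> ` U)) \<phi>) \<and>
     (\<forall>c\<in>A. \<forall>d\<in>A. holomorphic_map_on (snd c ` (fst c \<inter> fst d)) (transition c d))"

text \<open>A vector \<open>v\<close> of type (1,0) at \<open>p\<close> is the family \<open>t\<close> of its coordinate vectors: \<open>t c\<close> has the
  components \<open>v\<^sup>\<alpha>\<close> of \<open>v = v\<^sup>\<alpha> \<partial>/\<partial>z\<^sup>\<alpha>\<close> in the coordinates of the chart \<open>c\<close> around \<open>p\<close>.  The value at
  charts not around \<open>p\<close> is set to 0 to make the representation unique.\<close>

definition hol_tangent_space ::
    "('a, 'n::finite) chart set \<Rightarrow> 'a \<Rightarrow> (('a, 'n) chart \<Rightarrow> complex^'n) set" where
  "hol_tangent_space A p =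
     {t. (\<forall>c\<in>A. \<forall>d\<in>A. p \<in> fst c \<longrightarrow> p \<in> fst d \<longrightarrow>
            t d = frechet_derivative (transition c d) (at (snd c p)) (t c)) \<and>
         (\<forall>c. \<not> (c \<in> A \<and> p \<in> fst c) \<longrightarrow> t c = 0)}"

definition hol_tangent_bundle ::
    "'a topology \<Rightarrow> ('a, 'n::finite) chart set \<Rightarrow> ('a \<times> (('a, 'n) chart \<Rightarrow> complex^'n)) set" where
  "hol_tangent_bundle M A = Sigma (topspace M) (hol_tangent_space A)"

definition slit_tangent_bundle ::
    "'a topology \<Rightarrow> ('a, 'n::finite) chart set \<Rightarrow> ('a \<times> (('a, 'n) chart \<Rightarrow> complex^'n)) set" where
  "slit_tangent_bundle M A = {(p, t) \<in> hol_tangent_bundle M A. t \<noteq> (\<lambda>c. 0)}"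

text \<open>The point \<open>v\<^sup>\<alpha> \<partial>/\<partial>z\<^sup>\<alpha>\<close> of the tangent bundle over the point with coordinates \<open>z\<close> in the
  chart \<open>c\<close>, and a function on the tangent bundle in the induced coordinates \<open>(z, v)\<close>.\<close>

definition tangent_point :: "('a, 'n::finite) chart set \<Rightarrow> ('a, 'n) chart \<Rightarrow>
    (complex^'n) \<times> (complex^'n) \<Rightarrow> 'a \<times> (('a, 'n) chart \<Rightarrow> complex^'n)" where
  "tangent_point A c = (\<lambda>(z, v).
     (chart_inv c z,
      \<lambda>d. if d \<in> A \<and> chart_inv c z \<in> fst d
          then frechet_derivative (transition c d) (at z) v else 0))"

definition in_chart :: "('a, 'n::finite) chart set \<Rightarrow> ('a, 'n) chart \<Rightarrow>
    ('a \<times> (('a, 'n) chart \<Rightarrow> complex^'n) \<Rightarrow> 'b) \<Rightarrow> (complex^'n) \<times> (complex^'n) \<Rightarrow> 'b" where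
  "in_chart A c F = F \<circ> tangent_point A c"

definition slit_dom :: "('a, 'n::finite) chart \<Rightarrow> ((complex^'n) \<times> (complex^'n)) set" where
  "slit_dom c = (snd c ` fst c) \<times> (UNIV - {0})"


section \<open>Real and complex coordinate derivatives on the tangent bundle\<close>

text \<open>Real coordinates are indexed by \<open>'n + 'n\<close>: \<open>Inl \<alpha>\<close> stands for \<open>\<alpha>\<close> and \<open>Inr \<alpha>\<close> for
  \<open>\<alpha>\<^sup>* = \<alpha> + n\<close>.  Since \<open>z\<^sup>\<alpha> = x\<^sup>\<alpha> + i x\<^bsup>\<alpha>*\<^esup>\<close> and \<open>v\<^sup>\<alpha> = y\<^sup>\<alpha> + i y\<^bsup>\<alpha>*\<^esup>\<close>, the real coordinate vectors
  are \<open>axis \<alpha> 1\<close> and \<open>axis \<alpha> \<i>\<close>, and the real coordinates \<open>(x; y)\<close> of a point are the real and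
  imaginary parts of \<open>(z, v)\<close>.  This incorporates the identification of \<open>y\<close> with
  \<open>y\<^sub>o = (y - i J y) / 2\<close>.\<close>

fun real_frame :: "'n + 'n \<Rightarrow> complex^'n::finite" where
  "real_frame (Inl \<alpha>) = axis \<alpha> 1"
| "real_frame (Inr \<alpha>) = axis \<alpha> \<i>"

fun real_coord :: "'n + 'n \<Rightarrow> complex^'n::finite \<Rightarrow> real" where
  "real_coord (Inl \<alpha>) v = Re (v $ \<alpha>)"
| "real_coord (Inr \<alpha>) v = Im (v $ \<alpha>)"

definition dx :: "'n + 'n \<Rightarrow> ((complex^'n::finite) \<times> (complex^'n) \<Rightarrow> 'b::real_normed_vector) \<Rightarrow>
    (complex^'n) \<times> (complex^'n) \<Rightarrow> 'b" where
  "dx j f p = frechet_derivative f (at p) (real_frame j, 0)"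

definition dy :: "'n + 'n \<Rightarrow> ((complex^'n::finite) \<times> (complex^'n) \<Rightarrow> 'b::real_normed_vector) \<Rightarrow>
    (complex^'n) \<times> (complex^'n) \<Rightarrow> 'b" where
  "dy j f p = frechet_derivative f (at p) (0, real_frame j)"

definition dz :: "'n \<Rightarrow> ((complex^'n::finite) \<times> (complex^'n) \<Rightarrow> complex) \<Rightarrow>
    (complex^'n) \<times> (complex^'n) \<Rightarrow> complex" where
  "dz \<alpha> = wirtinger (axis \<alpha> 1, 0) (axis \<alpha> \<i>, 0)"

definition dz_bar :: "'n \<Rightarrow> ((complex^'n::finite) \<times> (complex^'n) \<Rightarrow> complex) \<Rightarrow>
    (complex^'n) \<times> (complex^'n) \<Rightarrow> complex" where
  "dz_bar \<alpha> = wirtinger_bar (axis \<alpha> 1, 0) (axis \<alpha> \<i>, 0)"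

definition dv :: "'n \<Rightarrow> ((complex^'n::finite) \<times> (complex^'n) \<Rightarrow> complex) \<Rightarrow>
    (complex^'n) \<times> (complex^'n) \<Rightarrow> complex" where
  "dv \<alpha> = wirtinger (0, axis \<alpha> 1) (0, axis \<alpha> \<i>)"

definition dv_bar :: "'n \<Rightarrow> ((complex^'n::finite) \<times> (complex^'n) \<Rightarrow> complex) \<Rightarrow>
    (complex^'n) \<times> (complex^'n) \<Rightarrow> complex" where
  "dv_bar \<alpha> = wirtinger_bar (0, axis \<alpha> 1) (0, axis \<alpha> \<i>)"


section \<open>Strongly convex complex Finsler metrics\<close>

text \<open>From here on, \<open>G\<close> is the coordinate expression of \<open>F\<^sup>2\<close> as a function of \<open>(z, v)\<close>.\<close>

definition fund_tensor :: "((complex^'n::finite) \<times> (complex^'n) \<Rightarrow> real) \<Rightarrow>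
    (complex^'n) \<times> (complex^'n) \<Rightarrow> real^('n + 'n)^('n + 'n)" where
  "fund_tensor G p = (\<chi> j k. 1/2 * dy j (dy k G) p)"

definition strongly_convex_complex_finsler :: "'a topology \<Rightarrow> ('a, 'n::finite) chart set \<Rightarrow>
    ('a \<times> (('a, 'n) chart \<Rightarrow> complex^'n) \<Rightarrow> real) \<Rightarrow> bool" where
  "strongly_convex_complex_finsler M A F \<longleftrightarrow>
     (\<forall>\<xi>\<in>hol_tangent_bundle M A. F \<xi> \<ge> 0) \<and>
     (\<forall>\<xi>\<in>slit_tangent_bundle M A. F \<xi> > 0) \<and>
     (\<forall>c\<in>A. smooth_on (slit_dom c) (in_chart A c F)) \<and>
     (\<forall>(p, t)\<in>hol_tangent_bundle M A. \<forall>a::complex.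
        F (p, \<lambda>c. a *s t c) = cmod a * F (p, t)) \<and>
     (\<forall>c\<in>A. \<forall>p\<in>slit_dom c. \<forall>\<xi>. \<xi> \<noteq> 0 \<longrightarrow>
        \<xi> \<bullet> (fund_tensor (in_chart A c (\<lambda>\<xi>. (F \<xi>)\<^sup>2)) p *v \<xi>) > 0)"


section \<open>The Cartan connection\<close>

definition fund_inv :: "((complex^'n::finite) \<times> (complex^'n) \<Rightarrow> real) \<Rightarrow>
    'n + 'n \<Rightarrow> 'n + 'n \<Rightarrow> (complex^'n) \<times> (complex^'n) \<Rightarrow> real" where
  "fund_inv G k l p = matrix_inv (fund_tensor G p) $ k $ l"

definition spray_coeff :: "((complex^'n::finite) \<times> (complex^'n) \<Rightarrow> real) \<Rightarrow>
    'n + 'n \<Rightarrow> (complex^'n) \<times> (complex^'n) \<Rightarrow> real" where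
  "spray_coeff G k p =
     1/4 * (\<Sum>l\<in>UNIV. fund_inv G k l p *
       ((\<Sum>a\<in>UNIV. dx a (dy l G) p * real_coord a (snd p)) - dx l G p))"

definition nonlin_conn :: "((complex^'n::finite) \<times> (complex^'n) \<Rightarrow> real) \<Rightarrow>
    'n + 'n \<Rightarrow> 'n + 'n \<Rightarrow> (complex^'n) \<times> (complex^'n) \<Rightarrow> real" where
  "nonlin_conn G k j = dy j (spray_coeff G k)"

definition delta_x :: "((complex^'n::finite) \<times> (complex^'n) \<Rightarrow> real) \<Rightarrow> 'n + 'n \<Rightarrow>
    ((complex^'n) \<times> (complex^'n) \<Rightarrow> real) \<Rightarrow> (complex^'n) \<times> (complex^'n) \<Rightarrow> real" where
  "delta_x G j f p = dx j f p - (\<Sum>k\<in>UNIV. nonlin_conn G k j p * dy k f p)"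

text \<open>\<open>cartan_hor G k j l\<close> is the coefficient with upper index \<open>k\<close> and lower indices \<open>j;l\<close>, and
  \<open>cartan_ver G k j l\<close> the one with lower indices \<open>jl\<close>.\<close>

definition cartan_hor :: "((complex^'n::finite) \<times> (complex^'n) \<Rightarrow> real) \<Rightarrow>
    'n + 'n \<Rightarrow> 'n + 'n \<Rightarrow> 'n + 'n \<Rightarrow> (complex^'n) \<times> (complex^'n) \<Rightarrow> real" where
  "cartan_hor G k j l p =
     (\<Sum>s\<in>UNIV. fund_inv G k s p / 2 *
       (delta_x G l (\<lambda>q. fund_tensor G q $ s $ j) p
        - delta_x G s (\<lambda>q. fund_tensor G q $ j $ l) p
        + delta_x G j (\<lambda>q. fund_tensor G q $ l $ s) p))"

definition cartan_ver :: "((complex^'n::finite) \<times> (complex^'n) \<Rightarrow> real) \<Rightarrow>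
    'n + 'n \<Rightarrow> 'n + 'n \<Rightarrow> 'n + 'n \<Rightarrow> (complex^'n) \<times> (complex^'n) \<Rightarrow> real" where
  "cartan_ver G k j l p =
     1/4 * (\<Sum>s\<in>UNIV. fund_inv G k s p * dy j (dy l (dy s G)) p)"

text \<open>A tangent vector \<open>X = (h, w)\<close> of the slit tangent bundle at \<open>p\<close> is
  \<open>h\<^sup>l \<partial>/\<partial>x\<^sup>l + w\<^sup>l \<partial>/\<partial>y\<^sup>l = h\<^sup>l \<delta>/\<delta>x\<^sup>l + \<theta>\<^sup>l \<partial>/\<partial>y\<^sup>l\<close>; \<open>ver_comp\<close> is \<open>\<theta>\<^sup>l\<close>.
  A section \<open>Y\<^sup>j \<partial>/\<partial>y\<^sup>j\<close> of the vertical bundle is given by the function \<open>Y\<close> with real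
  components \<open>Y\<^sup>j\<close>.  \<open>cartan_nabla G p X Y\<close> is the derivative of \<open>Y\<close> at \<open>p\<close> in direction \<open>X\<close>
  with respect to the linear connection determined by its values on the adapted frame.\<close>

definition ver_comp :: "((complex^'n::finite) \<times> (complex^'n) \<Rightarrow> real) \<Rightarrow>
    (complex^'n) \<times> (complex^'n) \<Rightarrow> (complex^'n) \<times> (complex^'n) \<Rightarrow> 'n + 'n \<Rightarrow> real" where
  "ver_comp G p X l =
     real_coord l (snd X) + (\<Sum>m\<in>UNIV. nonlin_conn G l m p * real_coord m (fst X))"

definition cartan_nabla :: "((complex^'n::finite) \<times> (complex^'n) \<Rightarrow> real) \<Rightarrow>
    (complex^'n) \<times> (complex^'n) \<Rightarrow> (complex^'n) \<times> (complex^'n) \<Rightarrow>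
    ((complex^'n) \<times> (complex^'n) \<Rightarrow> complex^'n) \<Rightarrow> complex^'n" where
  "cartan_nabla G p X Y =
     frechet_derivative Y (at p) X +
     (\<Sum>k\<in>UNIV. (\<Sum>j\<in>UNIV. \<Sum>l\<in>UNIV. real_coord j (Y p) *
         (real_coord l (fst X) * cartan_hor G k j l p + ver_comp G p X l * cartan_ver G k j l p))
       *\<^sub>R real_frame k)"

definition vert_J :: "complex^'n::finite \<Rightarrow> complex^'n" where
  "vert_J Y = \<i> *s Y"

lemma vert_J_real_frame:
  "vert_J (real_frame (Inl \<alpha>)) = real_frame (Inr \<alpha>)"
  "vert_J (real_frame (Inr \<alpha>)) = - real_frame (Inl \<alpha>)"
  by (auto simp: vert_J_def vec_eq_iff axis_def)

text \<open>\<open>\<nabla>J = 0\<close>, where \<open>W\<close> is the domain of a local section \<open>Y\<close> of the vertical bundle.\<close>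

definition cartan_J_parallel :: "('a, 'n::finite) chart set \<Rightarrow>
    ('a \<times> (('a, 'n) chart \<Rightarrow> complex^'n) \<Rightarrow> real) \<Rightarrow> bool" where
  "cartan_J_parallel A F \<longleftrightarrow>
     (\<forall>c\<in>A. \<forall>W Y. open W \<longrightarrow> W \<subseteq> slit_dom c \<longrightarrow> smooth_on W Y \<longrightarrow>
        (\<forall>p\<in>W. \<forall>X. let G = in_chart A c (\<lambda>\<xi>. (F \<xi>)\<^sup>2) in
           cartan_nabla G p X (\<lambda>q. vert_J (Y q)) = vert_J (cartan_nabla G p X Y)))"


section \<open>Holomorphic sectional curvature\<close>

definition levi_matrix :: "((complex^'n::finite) \<times> (complex^'n) \<Rightarrow> complex) \<Rightarrow>
    (complex^'n) \<times> (complex^'n) \<Rightarrow> complex^'n^'n" where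
  "levi_matrix G p = (\<chi> \<alpha> \<beta>. dv \<alpha> (dv_bar \<beta> G) p)"

definition chern_finsler :: "((complex^'n::finite) \<times> (complex^'n) \<Rightarrow> complex) \<Rightarrow>
    'n \<Rightarrow> 'n \<Rightarrow> (complex^'n) \<times> (complex^'n) \<Rightarrow> complex" where
  "chern_finsler G \<alpha> \<mu> p =
     (\<Sum>\<tau>\<in>UNIV. matrix_inv (levi_matrix G p) $ \<tau> $ \<alpha> * dz \<mu> (dv_bar \<tau> G) p)"

definition delta_bar :: "((complex^'n::finite) \<times> (complex^'n) \<Rightarrow> complex) \<Rightarrow> 'n \<Rightarrow>
    ((complex^'n) \<times> (complex^'n) \<Rightarrow> complex) \<Rightarrow> (complex^'n) \<times> (complex^'n) \<Rightarrow> complex" where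
  "delta_bar G \<nu> f p =
     dz_bar \<nu> f p - (\<Sum>\<alpha>\<in>UNIV. cnj (chern_finsler G \<alpha> \<nu> p) * dv_bar \<alpha> f p)"

definition constant_hol_sect_curv :: "('a, 'n::finite) chart set \<Rightarrow>
    ('a \<times> (('a, 'n) chart \<Rightarrow> complex^'n) \<Rightarrow> real) \<Rightarrow> real \<Rightarrow> bool" where
  "constant_hol_sect_curv A F c0 \<longleftrightarrow>
     (\<forall>c\<in>A. \<forall>(z, v)\<in>slit_dom c.
        let G = in_chart A c (\<lambda>\<xi>. complex_of_real ((F \<xi>)\<^sup>2)) in
        - 2 * (\<Sum>\<alpha>\<in>UNIV. \<Sum>\<mu>\<in>UNIV. \<Sum>\<nu>\<in>UNIV.
            dv \<alpha> G (z, v) * delta_bar G \<nu> (chern_finsler G \<alpha> \<mu>) (z, v) * v $ \<mu> * cnj (v $ \<nu>))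
        = complex_of_real c0 * (G (z, v))\<^sup>2)"


section \<open>Kaehler-Einstein metrics\<close>

text \<open>Below, \<open>H\<close> is the coordinate expression \<open>z \<mapsto> (H\<^sub>\<mu>\<^sub>\<nu>(z))\<close> of a Hermitian metric, the second
  index being the conjugate one.\<close>

definition hermitian_metric_on :: "(complex^'n::finite) set \<Rightarrow> (complex^'n \<Rightarrow> complex^'n^'n) \<Rightarrow> bool" where
  "hermitian_metric_on S H \<longleftrightarrow>
     smooth_on S H \<and>
     (\<forall>z\<in>S. (\<forall>\<mu> \<nu>. H z $ \<nu> $ \<mu> = cnj (H z $ \<mu> $ \<nu>)) \<and>
       (\<forall>v. v \<noteq> 0 \<longrightarrow> Re (\<Sum>\<mu>\<in>UNIV. \<Sum>\<nu>\<in>UNIV. H z $ \<mu> $ \<nu> * v $ \<mu> * cnj (v $ \<nu>)) > 0))"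

text \<open>The fundamental form \<open>\<i> H\<^sub>\<mu>\<^sub>\<nu> dz\<^sup>\<mu> \<and> dz_bar\<^sup>\<nu>\<close> evaluated on real tangent vectors; it is
  Kaehler if its exterior derivative vanishes, expressed on constant vector fields.\<close>

definition fund_form :: "(complex^'n::finite \<Rightarrow> complex^'n^'n) \<Rightarrow> complex^'n \<Rightarrow> complex^'n \<Rightarrow>
    complex^'n \<Rightarrow> complex" where
  "fund_form H u w z =
     \<i> * (\<Sum>\<mu>\<in>UNIV. \<Sum>\<nu>\<in>UNIV. H z $ \<mu> $ \<nu> * (u $ \<mu> * cnj (w $ \<nu>) - w $ \<mu> * cnj (u $ \<nu>)))"

definition kaehler_on :: "(complex^'n::finite) set \<Rightarrow> (complex^'n \<Rightarrow> complex^'n^'n) \<Rightarrow> bool" where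
  "kaehler_on S H \<longleftrightarrow> hermitian_metric_on S H \<and>
     (\<forall>z\<in>S. \<forall>u1 u2 u3.
        frechet_derivative (fund_form H u2 u3) (at z) u1
        - frechet_derivative (fund_form H u1 u3) (at z) u2
        + frechet_derivative (fund_form H u1 u2) (at z) u3 = 0)"

text \<open>The Christoffel symbols of the Chern connection (for a Kaehler metric, the Levi-Civita
  connection), \<open>\<nabla>\<^sub>\<mu> \<partial>\<^sub>\<beta> = \<Gamma>\<^sup>\<alpha>\<^sub>\<beta>\<^sub>\<mu> \<partial>\<^sub>\<alpha>\<close>, its curvature \<open>R(\<partial>\<^sub>\<mu>, \<partial>_\<nu>bar) \<partial>\<^sub>\<beta> = R\<^sup>\<alpha>\<^sub>\<beta>\<^sub>\<mu>\<^sub>\<nu> \<partial>\<^sub>\<alpha>\<close>, and the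
  Ricci tensor as the trace of \<open>X \<mapsto> R(X, \<partial>_\<nu>bar) \<partial>\<^sub>\<beta>\<close>.\<close>

definition christoffel :: "(complex^'n::finite \<Rightarrow> complex^'n^'n) \<Rightarrow> 'n \<Rightarrow> 'n \<Rightarrow> 'n \<Rightarrow>
    complex^'n \<Rightarrow> complex" where
  "christoffel H \<alpha> \<beta> \<mu> z =
     (\<Sum>\<tau>\<in>UNIV. matrix_inv (H z) $ \<tau> $ \<alpha> *
        wirtinger (axis \<mu> 1) (axis \<mu> \<i>) (\<lambda>w. H w $ \<beta> $ \<tau>) z)"

definition curv_tensor :: "(complex^'n::finite \<Rightarrow> complex^'n^'n) \<Rightarrow> 'n \<Rightarrow> 'n \<Rightarrow> 'n \<Rightarrow> 'n \<Rightarrow>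
    complex^'n \<Rightarrow> complex" where
  "curv_tensor H \<alpha> \<beta> \<mu> \<nu> z = - wirtinger_bar (axis \<nu> 1) (axis \<nu> \<i>) (christoffel H \<alpha> \<beta> \<mu>) z"

definition ricci :: "(complex^'n::finite \<Rightarrow> complex^'n^'n) \<Rightarrow> 'n \<Rightarrow> 'n \<Rightarrow> complex^'n \<Rightarrow> complex" where
  "ricci H \<beta> \<nu> z = (\<Sum>\<mu>\<in>UNIV. curv_tensor H \<mu> \<beta> \<mu> \<nu> z)"

text \<open>In each chart the matrices \<open>H z\<close> are uniquely determined by \<open>F\<close>, so the local \<open>H\<close> form one
  global Hermitian metric; the Einstein constant is the same in all charts.\<close>

definition kaehler_einstein :: "('a, 'n::finite) chart set \<Rightarrow>
    ('a \<times> (('a, 'n) chart \<Rightarrow> complex^'n) \<Rightarrow> real) \<Rightarrow> bool" where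
  "kaehler_einstein A F \<longleftrightarrow>
     (\<exists>k::real. \<forall>c\<in>A. \<exists>H.
        kaehler_on (snd c ` fst c) H \<and>
        (\<forall>z\<in>snd c ` fst c. \<forall>v.
           complex_of_real ((in_chart A c F (z, v))\<^sup>2) =
           (\<Sum>\<mu>\<in>UNIV. \<Sum>\<nu>\<in>UNIV. H z $ \<mu> $ \<nu> * v $ \<mu> * cnj (v $ \<nu>))) \<and>
        (\<forall>z\<in>snd c ` fst c. \<forall>\<mu> \<nu>. ricci H \<mu> \<nu> z = complex_of_real k * H z $ \<mu> $ \<nu>))"

end

theory Submission
  imports Defs
begin

text \<open>Everything happens in one chart.  There \<open>G = F\<^sup>2\<close> is a function of \<open>(z, v)\<close>; let \<open>J\<close> be
  multiplication by \<open>\<i>\<close>, let \<open>hess\<close> be the real Hessian of \<open>G\<close> in the fibre variable, and let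
  \<open>third\<close> be the symmetric trilinear form of its third fibre derivatives.

  \<^emph>\<open>Vertical directions make \<open>F\<close> Hermitian.\<close>  The vertical derivative \<open>K(a, b)\<close> of the constant
  section \<open>a\<close> in direction \<open>b\<close> is given by \<open>hess(c, K(a, b)) = third(a, b, c) / 2\<close>, and
  \<open>\<nabla>J = 0\<close> says \<open>K(Ja, b) = J K(a, b)\<close>.  By homogeneity \<open>third(v, b, c) = 0\<close>, so \<open>K(v, b) = 0\<close>,
  so \<open>K(Jv, b) = 0\<close>, so \<open>third(Jv, b, c) = 0\<close>.  But \<open>G\<close> is constant along the circles
  \<open>e\<^bsup>it\<^esup> v\<close>, and two differentiations of this fact express \<open>third(a, b, Jv)\<close> as
  \<open>- hess(a, Jb) - hess(b, Ja)\<close>.  Hence \<open>J\<close> is skew for \<open>hess\<close> at every point (\<open>hess_J\<close>).  One more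
  derivative makes \<open>J\<close> skew for \<open>third\<close> in every pair of slots, which a symmetric trilinear form
  survives only by being zero (\<open>third_zero\<close>).  So \<open>hess\<close> depends on \<open>z\<close> alone, and \<open>G\<close> is a
  Hermitian form \<open>H\<^sub>\<mu>\<^sub>\<nu>(z) v\<^sup>\<mu> cnj(v\<^sup>\<nu>)\<close>.

  \<^emph>\<open>Horizontal directions make it Kaehler.\<close>  With \<open>third = 0\<close> the horizontal coefficients of the
  Cartan connection are the Levi-Civita symbols of the real metric \<open>Re H\<close>, so \<open>J\<close> is parallel
  for a torsion-free metric connection.  Written out, this is the identity \<open>kaehler_real\<close>, which is
  the symmetry of \<open>\<partial>\<^sub>\<mu> H\<^sub>\<beta>\<^sub>\<tau>\<close> in \<open>\<mu>, \<beta>\<close>, and whose cyclic sum is the closedness of the fundamental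
  form.

  \<^emph>\<open>Constant curvature makes it Einstein.\<close>  For such a \<open>G\<close> the Chern-Finsler coefficients are
  linear in \<open>v\<close>, and constant holomorphic sectional curvature reads
  \<open>2 R\<^sub>\<beta>\<^sub>\<sigma>\<^sub>\<mu>\<^sub>\<nu> v\<^sup>\<beta> cnj(v\<^sup>\<sigma>) v\<^sup>\<mu> cnj(v\<^sup>\<nu>) = c (H\<^sub>\<beta>\<^sub>\<sigma> v\<^sup>\<beta> cnj(v\<^sup>\<sigma>))\<^sup>2\<close>.  The Kaehler symmetries of \<open>R\<close> allow
  polarisation (\<open>biquadratic_form_zero\<close>), which gives
  \<open>R\<^sub>\<beta>\<^sub>\<sigma>\<^sub>\<mu>\<^sub>\<nu> = c/4 (H\<^sub>\<beta>\<^sub>\<sigma> H\<^sub>\<mu>\<^sub>\<nu> + H\<^sub>\<beta>\<^sub>\<nu> H\<^sub>\<mu>\<^sub>\<sigma>)\<close>, and the trace is \<open>Ric = c (n + 1) / 4 \<cdot> H\<close>, with the same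
  constant in all charts.\<close>

section \<open>Directional derivatives and smooth functions\<close>

abbreviation ddir :: "'a::real_normed_vector \<Rightarrow> ('a \<Rightarrow> 'b::real_normed_vector) \<Rightarrow> 'a \<Rightarrow> 'b" where
  "ddir u f p \<equiv> frechet_derivative f (at p) u"

lemma ddir_eq: "(f has_derivative f') (at p) \<Longrightarrow> ddir u f p = f' u"
  by (metis frechet_derivative_at)

lemma ddir_cong:
  assumes "open S" "p \<in> S" "\<And>q. q \<in> S \<Longrightarrow> f q = g q"
  shows "ddir u f p = ddir u g p"
proof -
  have "(f has_derivative f') (at p) \<longleftrightarrow> (g has_derivative f') (at p)" for f'
    using has_derivative_transform_within_open[OF _ assms(1,2), of f f' UNIV g]
      has_derivative_transform_within_open[OF _ assms(1,2), of g f' UNIV f] assms(3) by auto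
  then show ?thesis by (simp add: frechet_derivative_def)
qed

lemma ddir_linear: "f differentiable (at p) \<Longrightarrow> linear (\<lambda>u. ddir u f p)"
  by (rule linear_frechet_derivative)

lemma differentiable_cong_open:
  assumes "open S" "p \<in> S" "\<And>q. q \<in> S \<Longrightarrow> f q = g q"
  shows "f differentiable (at p) \<longleftrightarrow> g differentiable (at p)"
  using has_derivative_transform_within_open[OF _ assms(1,2), of f _ UNIV g]
      has_derivative_transform_within_open[OF _ assms(1,2), of g _ UNIV f] assms(3)
  unfolding differentiable_def by metis

lemma ddir_bounded_linear:
  assumes "bounded_linear L" "f differentiable (at p)"
  shows "ddir u (\<lambda>x. L (f x)) p = L (ddir u f p)"
  using bounded_linear.has_derivative[OF assms(1) assms(2)[unfolded frechet_derivative_works]]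
  by (rule ddir_eq)

lemma ddir_add:
  assumes "f differentiable (at p)" "g differentiable (at p)"
  shows "ddir u (\<lambda>x. f x + g x) p = ddir u f p + ddir u g p"
  using has_derivative_add[OF assms[unfolded frechet_derivative_works]] by (rule ddir_eq)

lemma ddir_sum:
  assumes "\<And>i. i \<in> I \<Longrightarrow> f i differentiable (at p)"
  shows "ddir u (\<lambda>x. \<Sum>i\<in>I. f i x) p = (\<Sum>i\<in>I. ddir u (f i) p)"
  using has_derivative_sum[of I f "\<lambda>i u. ddir u (f i) p" "at p"] assms
  by (intro ddir_eq) (auto simp: frechet_derivative_works)

lemma ddir_bilinear:
  assumes "bounded_bilinear B" "f differentiable (at p)" "g differentiable (at p)"
  shows "ddir u (\<lambda>x. B (f x) (g x)) p = B (f p) (ddir u g p) + B (ddir u f p) (g p)"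
  using bounded_bilinear.FDERIV[OF assms(1) assms(2,3)[unfolded frechet_derivative_works]]
  by (rule ddir_eq)

lemma differentiable_bilinear:
  assumes "bounded_bilinear B" "f differentiable (at p)" "g differentiable (at p)"
  shows "(\<lambda>x. B (f x) (g x)) differentiable (at p)"
  using bounded_bilinear.FDERIV[OF assms(1) assms(2,3)[unfolded frechet_derivative_works]]
  by (auto simp: differentiable_def)

lemma differentiable_bounded_linear:
  assumes "bounded_linear L" "f differentiable (at p)"
  shows "(\<lambda>x. L (f x)) differentiable (at p)"
  using bounded_linear.has_derivative[OF assms(1) assms(2)[unfolded frechet_derivative_works]]
  by (auto simp: differentiable_def)

text \<open>All closure properties of \<open>smooth_on\<close> are inductions on the order in \<open>C_k_on\<close>.  Since its successor
  step speaks of \<open>frechet_derivative\<close>, a formula for the derivative on \<open>S\<close> can be substituted only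
  because \<open>S\<close> is open; hence this congruence rule.\<close>

lemma C_k_on_cong:
  assumes "open S" "\<And>q. q \<in> S \<Longrightarrow> f q = g q" "C_k_on k S f"
  shows "C_k_on k S g"
  using assms(2,3)
proof (induction k arbitrary: f g)
  case 0
  then show ?case using continuous_on_cong[of S S f g] by simp
next
  case (Suc k)
  have "ddir u f q = ddir u g q" if "q \<in> S" for u q
    using ddir_cong[OF assms(1) that] Suc.prems(1) by blast
  then have "C_k_on k S (ddir u g)" for u
    using Suc.IH[of "ddir u f" "ddir u g"] Suc.prems(2) by simp
  moreover have "\<forall>x\<in>S. g differentiable (at x)"
    using Suc.prems differentiable_cong_open[OF assms(1), of _ f g] by auto
  ultimately show ?case by simp
qed

lemma smooth_on_cong:
  assumes "open S" "\<And>q. q \<in> S \<Longrightarrow> f q = g q" "smooth_on S f"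
  shows "smooth_on S g"
  using assms C_k_on_cong unfolding smooth_on_def by metis

lemma C_k_on_Suc_lower: "C_k_on (Suc k) S f \<Longrightarrow> C_k_on k S f"
proof (induction k arbitrary: f)
  case 0
  then show ?case
    by (auto intro!: continuous_at_imp_continuous_on differentiable_imp_continuous_within)
next
  case (Suc k)
  have "C_k_on k S (ddir u f)" for u
    using Suc.prems by (intro Suc.IH) simp
  then show ?case using Suc.prems by simp
qed

lemma smooth_on_differentiable: "smooth_on S f \<Longrightarrow> p \<in> S \<Longrightarrow> f differentiable (at p)"
  using C_k_on.simps(2)[of 0 S f] unfolding smooth_on_def by blast

lemma smooth_on_ddir: "smooth_on S f \<Longrightarrow> smooth_on S (ddir u f)"
  unfolding smooth_on_def using C_k_on.simps(2)[of _ S f] by blast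

lemma C_k_on_add:
  assumes "open S" "C_k_on k S f" "C_k_on k S g"
  shows "C_k_on k S (\<lambda>x. f x + g x)"
  using assms(2,3)
proof (induction k arbitrary: f g)
  case 0
  then show ?case by (simp add: continuous_on_add)
next
  case (Suc k)
  have "C_k_on k S (ddir u (\<lambda>x. f x + g x))" for u
    by (rule C_k_on_cong[OF assms(1) _ Suc.IH[of "ddir u f" "ddir u g"]])
      (use Suc.prems in \<open>auto simp: ddir_add\<close>)
  then show ?case using Suc.prems by (auto intro!: differentiable_add)
qed

lemma C_k_on_bounded_linear:
  assumes "open S" "bounded_linear L" "C_k_on k S f"
  shows "C_k_on k S (\<lambda>x. L (f x))"
  using assms(3)
proof (induction k arbitrary: f)
  case 0
  then show ?case by (simp add: bounded_linear.continuous_on[OF assms(2)])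
next
  case (Suc k)
  have "C_k_on k S (ddir u (\<lambda>x. L (f x)))" for u
    by (rule C_k_on_cong[OF assms(1) _ Suc.IH[of "ddir u f"]])
      (use Suc.prems in \<open>auto simp: ddir_bounded_linear[OF assms(2)]\<close>)
  then show ?case using Suc.prems by (auto intro!: differentiable_bounded_linear[OF assms(2)])
qed

lemma C_k_on_bilinear:
  assumes "open S" "bounded_bilinear B" "C_k_on k S f" "C_k_on k S g"
  shows "C_k_on k S (\<lambda>x. B (f x) (g x))"
  using assms(3,4)
proof (induction k arbitrary: f g)
  case 0
  then show ?case by (simp add: bounded_bilinear.continuous_on[OF assms(2)])
next
  case (Suc k)
  have "C_k_on k S (ddir u (\<lambda>x. B (f x) (g x)))" for u
  proof (rule C_k_on_cong[OF assms(1)])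
    show "C_k_on k S (\<lambda>x. B (f x) (ddir u g x) + B (ddir u f x) (g x))"
    proof (intro C_k_on_add[OF assms(1)] Suc.IH)
      show "C_k_on k S f" "C_k_on k S g"
        using Suc.prems by (auto intro: C_k_on_Suc_lower simp del: C_k_on.simps)
    qed (use Suc.prems in auto)
  qed (use Suc.prems in \<open>auto simp: ddir_bilinear[OF assms(2)]\<close>)
  then show ?case using Suc.prems by (auto intro!: differentiable_bilinear[OF assms(2)])
qed

lemma smooth_on_add: "open S \<Longrightarrow> smooth_on S f \<Longrightarrow> smooth_on S g \<Longrightarrow> smooth_on S (\<lambda>x. f x + g x)"
  by (simp add: smooth_on_def C_k_on_add)

lemma smooth_on_bounded_linear: "open S \<Longrightarrow> bounded_linear L \<Longrightarrow> smooth_on S f \<Longrightarrow> smooth_on S (\<lambda>x. L (f x))"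
  by (simp add: smooth_on_def C_k_on_bounded_linear)

lemma smooth_on_bilinear: "open S \<Longrightarrow> bounded_bilinear B \<Longrightarrow> smooth_on S f \<Longrightarrow> smooth_on S g \<Longrightarrow>
   smooth_on S (\<lambda>x. B (f x) (g x))"
  by (simp add: smooth_on_def C_k_on_bilinear)

lemma C_k_on_const: "C_k_on k S (\<lambda>_. a)"
  by (induction k arbitrary: a) auto

lemma smooth_on_const: "smooth_on S (\<lambda>_. a)"
  by (simp add: smooth_on_def C_k_on_const)

lemma smooth_on_sum:
  assumes "open S" "\<And>i. i \<in> I \<Longrightarrow> smooth_on S (f i)"
  shows "smooth_on S (\<lambda>x. \<Sum>i\<in>I. f i x)"
  using assms(2) by (induction I rule: infinite_finite_induct)
    (auto simp: smooth_on_const intro!: smooth_on_add[OF assms(1)])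

text \<open>Freezing the fibre variable: smoothness of the coefficients in \<open>z\<close> alone is read off from a smooth
  function of \<open>(z, v)\<close> at a fixed nonzero \<open>v\<close>.\<close>

lemma ddir_affine_slice:
  assumes "f differentiable (at (z, v))"
  shows "ddir u (\<lambda>z. f (z, v)) z = ddir (u, 0) f (z, v)"
    and "(\<lambda>z. f (z, v)) differentiable (at z)"
proof -
  have "((\<lambda>z. (z, v)) has_derivative (\<lambda>u. (u, 0))) (at z)"
    by (auto intro!: derivative_eq_intros)
  from diff_chain_at[OF this, of f] assms[unfolded frechet_derivative_works]
  have "((\<lambda>z. f (z, v)) has_derivative (\<lambda>u. ddir (u, 0) f (z, v))) (at z)"
    by (simp add: comp_def)
  then show "ddir u (\<lambda>z. f (z, v)) z = ddir (u, 0) f (z, v)"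
    and "(\<lambda>z. f (z, v)) differentiable (at z)"
    by (auto simp: ddir_eq differentiable_def)
qed

lemma C_k_on_slice:
  assumes "open S" "C_k_on k (S \<times> V) f" "v \<in> V"
  shows "C_k_on k S (\<lambda>z. f (z, v))"
  using assms(2)
proof (induction k arbitrary: f)
  case 0
  have "continuous_on S (\<lambda>z. f (z, v))"
    by (rule continuous_on_compose2[of "S \<times> V" f]) (use 0 assms(3) in \<open>auto intro!: continuous_intros\<close>)
  then show ?case by simp
next
  case (Suc k)
  have d: "f differentiable (at (z, v))" if "z \<in> S" for z
    using Suc.prems that assms(3) by simp
  have "C_k_on k S (ddir u (\<lambda>z. f (z, v)))" for u
    by (rule C_k_on_cong[OF assms(1) _ Suc.IH[of "ddir (u, 0) f"]])
      (use Suc.prems ddir_affine_slice(1)[OF d] in \<open>auto\<close>)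
  then show ?case using ddir_affine_slice(2)[OF d] by auto
qed

lemma smooth_on_slice:
  "open S \<Longrightarrow> smooth_on (S \<times> V) f \<Longrightarrow> v \<in> V \<Longrightarrow> smooth_on S (\<lambda>z. f (z, v))"
  unfolding smooth_on_def using C_k_on_slice by blast

section \<open>Symmetry of second derivatives\<close>

text \<open>The second difference \<open>f(p + tu + tw) - f(p + tu) - f(p + tw) + f(p)\<close> is symmetric in \<open>u\<close> and \<open>w\<close>.
  The mean value theorem in direction \<open>u\<close> turns it into a difference of values of the derivative
  along \<open>u\<close>, and differentiability of that derivative at the single point \<open>p\<close> identifies the
  \<open>t\<^sup>2\<close> coefficient as the iterated derivative in one of the two orders.\<close>

lemma second_difference_estimate:
  fixes f :: "'a::real_normed_vector \<Rightarrow> real"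
  assumes S: "open S" "p \<in> S" and f: "\<And>q. q \<in> S \<Longrightarrow> f differentiable (at q)"
    and fu: "ddir u f differentiable (at p)" and e: "e > 0"
  shows "\<exists>d>0. \<forall>t. 0 < t \<and> t < d \<longrightarrow>
    \<bar>f (p + t *\<^sub>R u + t *\<^sub>R w) - f (p + t *\<^sub>R u) - f (p + t *\<^sub>R w) + f p
      - t\<^sup>2 * ddir w (ddir u f) p\<bar> \<le> e * t\<^sup>2"
proof -
  \<comment> \<open>\<open>t N\<close> bounds the sum of the distances from \<open>p\<close> to the two points where the derivative is compared; the summand 1 keeps it positive.\<close>
  define N where "N = 2 * norm u + norm w + 1"
  have N: "N > 0" unfolding N_def by (smt (verit) norm_ge_zero)
  define L where "L = (\<lambda>w. ddir w (ddir u f) p)"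
  have hL: "(ddir u f has_derivative L) (at p)"
    unfolding L_def using fu frechet_derivative_works by blast
  interpret L: bounded_linear L using hL by (rule has_derivative_bounded_linear)
  obtain r where r: "r > 0" "ball p r \<subseteq> S" using S openE by blast
  obtain d where d: "d > 0" and
    dd: "\<And>y. norm (y - p) < d \<Longrightarrow> \<bar>ddir u f y - ddir u f p - L (y - p)\<bar> \<le> e / N * norm (y - p)"
    using hL[unfolded has_derivative_at_alt] e N by (metis divide_pos_pos real_norm_def)
  define m where "m = min r d / N"
  have m: "m > 0" "m * N \<le> r" "m * N \<le> d" using r d N unfolding m_def by auto
  show ?thesis
  proof (intro exI[of _ m] conjI allI impI m(1))
    fix t assume t: "0 < t \<and> t < m"
    have tN: "t * N < r" "t * N < d"
      using mult_strict_right_mono[of t m N] t m N by linarith+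
    have nb: "norm (s *\<^sub>R u + k *\<^sub>R w) \<le> t * (norm u + norm w)" if "0 \<le> s" "s \<le> t" "0 \<le> k" "k \<le> t" for s k
    proof -
      have "norm (s *\<^sub>R u + k *\<^sub>R w) \<le> s * norm u + k * norm w"
        using that norm_triangle_ineq[of "s *\<^sub>R u" "k *\<^sub>R w"] by simp
      also have "\<dots> \<le> t * norm u + t * norm w"
        using that by (intro add_mono mult_right_mono) auto
      finally show ?thesis by (simp add: algebra_simps)
    qed
    have nN: "t * (norm u + norm w) < t * N" using t unfolding N_def
      by (intro mult_strict_left_mono) (auto intro: add_strict_increasing2)
    have inS: "p + s *\<^sub>R u + k *\<^sub>R w \<in> S" if "0 \<le> s" "s \<le> t" "0 \<le> k" "k \<le> t" for s k
    proof -
      have "p + s *\<^sub>R u + k *\<^sub>R w \<in> ball p r"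
        using nb[OF that] nN tN(1) by (simp add: dist_norm add.assoc norm_minus_commute
         flip: norm_minus_cancel[of "s *\<^sub>R u + k *\<^sub>R w"])
      then show ?thesis using r(2) by blast
    qed
    have der: "((\<lambda>s. f (p + s *\<^sub>R u + k *\<^sub>R w)) has_real_derivative ddir u f (p + s *\<^sub>R u + k *\<^sub>R w)) (at s)"
      if "0 \<le> s" "s \<le> t" "0 \<le> k" "k \<le> t" for s k
    proof -
      let ?q = "p + s *\<^sub>R u + k *\<^sub>R w"
      have 1: "((\<lambda>s. p + s *\<^sub>R u + k *\<^sub>R w) has_derivative (\<lambda>h. h *\<^sub>R u)) (at s)"
        by (auto intro!: derivative_eq_intros)
      have 2: "(f has_derivative (\<lambda>u. ddir u f ?q)) (at ?q)"
        using f[OF inS[OF that]] frechet_derivative_works by blast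
      have "((\<lambda>s. f (p + s *\<^sub>R u + k *\<^sub>R w)) has_derivative (\<lambda>h. ddir (h *\<^sub>R u) f ?q)) (at s)"
        using diff_chain_at[OF 1 2] by (simp add: comp_def)
      then show ?thesis unfolding has_field_derivative_def
        using linear_scale[OF ddir_linear[OF f[OF inS[OF that]]]]
        by (simp add: mult.commute[of _ "ddir u f ?q"] mult_commute_abs)
    qed
    \<comment> \<open>The second difference is \<open>h t - h 0\<close>; the factor \<open>0\<close> lets both terms be instances of \<open>der\<close>.\<close>
    define h where "h = (\<lambda>s. f (p + s *\<^sub>R u + t *\<^sub>R w) - f (p + s *\<^sub>R u + 0 *\<^sub>R w))"
    have hd: "(h has_real_derivative (ddir u f (p + s *\<^sub>R u + t *\<^sub>R w) - ddir u f (p + s *\<^sub>R u + 0 *\<^sub>R w))) (at s)"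
      if "0 \<le> s" "s \<le> t" for s
      unfolding h_def using that t by (intro DERIV_diff der) auto
    obtain s where s: "0 < s" "s < t" and
      hs: "h t - h 0 = (t - 0) * (ddir u f (p + s *\<^sub>R u + t *\<^sub>R w) - ddir u f (p + s *\<^sub>R u + 0 *\<^sub>R w))"
      using MVT2[of 0 t h, OF _ hd] t by blast
    define y1 where "y1 = p + s *\<^sub>R u + t *\<^sub>R w"
    define y2 where "y2 = p + s *\<^sub>R u"
    have n1: "norm (y1 - p) \<le> t * (norm u + norm w)"
      using nb[of s t] s t unfolding y1_def by (simp add: add.assoc)
    have n2: "norm (y2 - p) \<le> t * norm u"
      using s unfolding y2_def by (simp add: mult_right_mono)
    have n2': "t * norm u \<le> t * (norm u + norm w)" using t by (simp add: mult_left_mono)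
    have e1: "\<bar>ddir u f y1 - ddir u f p - L (y1 - p)\<bar> \<le> e / N * norm (y1 - p)"
      using n1 nN tN by (intro dd) linarith
    have e2: "\<bar>ddir u f y2 - ddir u f p - L (y2 - p)\<bar> \<le> e / N * norm (y2 - p)"
      using n2 n2' nN tN by (intro dd) linarith
    have "L (y1 - p) - L (y2 - p) = t * L w"
      unfolding y1_def y2_def by (simp add: L.add L.scaleR)
    then have "\<bar>ddir u f y1 - ddir u f y2 - t * L w\<bar> \<le> e / N * norm (y1 - p) + e / N * norm (y2 - p)"
      using e1 e2 by linarith
    also have "\<dots> \<le> e / N * (t * (norm u + norm w)) + e / N * (t * norm u)"
      using n1 n2 e N by (intro add_mono mult_left_mono) auto
    also have "\<dots> = e / N * (t * (N - 1))"
      unfolding distrib_left[symmetric] N_def by (simp add: algebra_simps)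
    also have "\<dots> \<le> e / N * (t * N)" using e N t by (intro mult_left_mono) auto
    also have "\<dots> = e * t" using N by simp
    finally have fin: "\<bar>ddir u f y1 - ddir u f y2 - t * L w\<bar> \<le> e * t" .
    have "f (p + t *\<^sub>R u + t *\<^sub>R w) - f (p + t *\<^sub>R u) - f (p + t *\<^sub>R w) + f p - t\<^sup>2 * L w
        = t * (ddir u f y1 - ddir u f y2 - t * L w)"
      using hs unfolding h_def y1_def y2_def by (simp add: algebra_simps power2_eq_square)
    then have "\<bar>f (p + t *\<^sub>R u + t *\<^sub>R w) - f (p + t *\<^sub>R u) - f (p + t *\<^sub>R w) + f p - t\<^sup>2 * L w\<bar> \<le> t * (e * t)"
      using fin t by (simp add: abs_mult)
    then show "\<bar>f (p + t *\<^sub>R u + t *\<^sub>R w) - f (p + t *\<^sub>R u) - f (p + t *\<^sub>R w) + f p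
      - t\<^sup>2 * ddir w (ddir u f) p\<bar> \<le> e * t\<^sup>2"
      unfolding L_def by (simp add: power2_eq_square mult.left_commute)
  qed
qed

text \<open>Two candidates for the \<open>t\<^sup>2\<close> coefficient of the same second difference must agree.\<close>

lemma ddir_commute_real:
  fixes f :: "'a::real_normed_vector \<Rightarrow> real"
  assumes S: "open S" "p \<in> S" and f: "\<And>q. q \<in> S \<Longrightarrow> f differentiable (at q)"
    and fu: "ddir u f differentiable (at p)" and fw: "ddir w f differentiable (at p)"
  shows "ddir w (ddir u f) p = ddir u (ddir w f) p"
proof (rule ccontr)
  let ?a = "ddir w (ddir u f) p" and ?b = "ddir u (ddir w f) p"
  assume "?a \<noteq> ?b"
  define e where "e = \<bar>?a - ?b\<bar> / 3"
  have e: "e > 0" and e3: "\<bar>?a - ?b\<bar> = 3 * e" using \<open>?a \<noteq> ?b\<close> unfolding e_def by simp_all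
  define X where "X t = f (p + t *\<^sub>R u + t *\<^sub>R w) - f (p + t *\<^sub>R u) - f (p + t *\<^sub>R w) + f p" for t
  obtain d1 where d1: "d1 > 0" "\<And>t. 0 < t \<Longrightarrow> t < d1 \<Longrightarrow> \<bar>X t - t\<^sup>2 * ?a\<bar> \<le> e * t\<^sup>2"
    using second_difference_estimate[OF S f fu e, of w] unfolding X_def by blast
  obtain d2 where d2: "d2 > 0" "\<And>t. 0 < t \<Longrightarrow> t < d2 \<Longrightarrow> \<bar>X t - t\<^sup>2 * ?b\<bar> \<le> e * t\<^sup>2"
    using second_difference_estimate[OF S f fw e, of u] unfolding X_def
    by (auto simp: algebra_simps)
  define t where "t = min d1 d2 / 2"
  have t: "0 < t" "t < d1" "t < d2" using d1 d2 unfolding t_def by auto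
  have "\<bar>t\<^sup>2 * ?a - t\<^sup>2 * ?b\<bar> \<le> 2 * (e * t\<^sup>2)"
    using d1(2)[OF t(1,2)] d2(2)[OF t(1,3)] by linarith
  then have "t\<^sup>2 * \<bar>?a - ?b\<bar> \<le> t\<^sup>2 * (2 * e)"
    by (simp add: abs_mult mult.commute mult.left_commute flip: right_diff_distrib)
  then have "\<bar>?a - ?b\<bar> \<le> 2 * e" using t(1) by simp
  then show False using e e3 by simp
qed

text \<open>The vector-valued case follows by pairing the values with every vector.\<close>

lemma ddir_commute:
  fixes f :: "'a::real_normed_vector \<Rightarrow> 'b::real_inner"
  assumes S: "open S" "p \<in> S" and f: "smooth_on S f"
  shows "ddir w (ddir u f) p = ddir u (ddir w f) p"
proof -
  have bl: "bounded_linear (\<lambda>x::'b. x \<bullet> b)" for b by (rule bounded_linear_inner_left)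
  have d: "f differentiable (at q)" if "q \<in> S" for q
    using f smooth_on_differentiable that by blast
  have d1: "ddir u f differentiable (at q)" if "q \<in> S" for q u
    using f smooth_on_differentiable smooth_on_ddir that by blast
  have i1: "ddir u (\<lambda>x. f x \<bullet> b) q = ddir u f q \<bullet> b" if "q \<in> S" for u b q
    using ddir_bounded_linear[OF bl d[OF that]] .
  have dd: "ddir u (\<lambda>x. f x \<bullet> b) differentiable (at p)" for u b
    using differentiable_cong_open[OF S, of "ddir u (\<lambda>x. f x \<bullet> b)" "\<lambda>q. ddir u f q \<bullet> b"] i1
      differentiable_bounded_linear[OF bl d1[OF S(2)]] by blast
  have i2: "ddir w (ddir u (\<lambda>x. f x \<bullet> b)) p = ddir w (ddir u f) p \<bullet> b" for u w b
  proof -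
    have "ddir w (ddir u (\<lambda>x. f x \<bullet> b)) p = ddir w (\<lambda>q. ddir u f q \<bullet> b) p"
      by (rule ddir_cong[OF S i1])
    also have "\<dots> = ddir w (ddir u f) p \<bullet> b"
      by (rule ddir_bounded_linear[OF bl d1[OF S(2)]])
    finally show ?thesis .
  qed
  have "ddir w (ddir u f) p \<bullet> b = ddir u (ddir w f) p \<bullet> b" for b
    using ddir_commute_real[OF S differentiable_bounded_linear[OF bl d] dd dd, of b w u] i2 by simp
  then show ?thesis using vector_eq_rdot by blast
qed

text \<open>Product rule for \<open>q \<mapsto> df\<^sub>q(W(q))\<close>.  It is what turns Euler type identities, which hold for the
  moving direction \<open>W(q) = v\<close> or \<open>W(q) = Jv\<close>, into identities between higher derivatives.  Expanding
  \<open>W\<close> in a basis reduces it to the scalar product rule.\<close>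

lemma ddir_along_field:
  fixes f :: "'a::euclidean_space \<Rightarrow> 'b::real_normed_vector"
  assumes S: "open S" "p \<in> S" and f: "smooth_on S f"
    and W: "W differentiable (at p)"
  shows "ddir b (\<lambda>q. ddir (W q) f q) p = ddir b (ddir (W p) f) p + ddir (ddir b W p) f p"
proof -
  have lin: "linear (\<lambda>u. ddir u f q)" if "q \<in> S" for q
    using f smooth_on_differentiable that ddir_linear by blast
  have d1: "ddir u f differentiable (at p)" for u
    using f smooth_on_differentiable smooth_on_ddir S by blast
  have ex: "ddir a f q = (\<Sum>i\<in>Basis. (a \<bullet> i) *\<^sub>R ddir i f q)" if "q \<in> S" for a q
    using linear_sum[OF lin[OF that], of "\<lambda>i. (a \<bullet> i) *\<^sub>R i" Basis] linear_scale[OF lin[OF that]]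
    by (simp add: euclidean_representation)
  have ex2: "ddir b (ddir a f) p = (\<Sum>i\<in>Basis. (a \<bullet> i) *\<^sub>R ddir b (ddir i f) p)" for a
  proof -
    have "ddir b (ddir a f) p = ddir b (\<lambda>q. \<Sum>i\<in>Basis. (a \<bullet> i) *\<^sub>R ddir i f q) p"
      by (rule ddir_cong[OF S ex])
    also have "\<dots> = (\<Sum>i\<in>Basis. ddir b (\<lambda>q. (a \<bullet> i) *\<^sub>R ddir i f q) p)"
      by (rule ddir_sum) (intro differentiable_bounded_linear[OF bounded_linear_scaleR_right] d1)
    also have "\<dots> = (\<Sum>i\<in>Basis. (a \<bullet> i) *\<^sub>R ddir b (ddir i f) p)"
      by (intro sum.cong refl ddir_bounded_linear[OF bounded_linear_scaleR_right] d1)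
    finally show ?thesis .
  qed
  have Wi: "(\<lambda>q. W q \<bullet> i) differentiable (at p)" for i
    by (rule differentiable_bounded_linear[OF bounded_linear_inner_left W])
  have dWi: "ddir b (\<lambda>q. W q \<bullet> i) p = ddir b W p \<bullet> i" for i
    by (rule ddir_bounded_linear[OF bounded_linear_inner_left W])
  have "ddir b (\<lambda>q. ddir (W q) f q) p = ddir b (\<lambda>q. \<Sum>i\<in>Basis. (W q \<bullet> i) *\<^sub>R ddir i f q) p"
    by (rule ddir_cong[OF S ex])
  also have "\<dots> = (\<Sum>i\<in>Basis. ddir b (\<lambda>q. (W q \<bullet> i) *\<^sub>R ddir i f q) p)"
    by (rule ddir_sum) (intro differentiable_bilinear[OF bounded_bilinear_scaleR] d1 Wi)
  also have "\<dots> = (\<Sum>i\<in>Basis. (W p \<bullet> i) *\<^sub>R ddir b (ddir i f) p + (ddir b W p \<bullet> i) *\<^sub>R ddir i f p)"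
    by (intro sum.cong refl) (simp add: ddir_bilinear[OF bounded_bilinear_scaleR Wi d1] dWi)
  also have "\<dots> = ddir b (ddir (W p) f) p + ddir (ddir b W p) f p"
    by (simp add: sum.distrib ex2[of "W p"] ex[OF S(2), of "ddir b W p"])
  finally show ?thesis .
qed

section \<open>Real coordinates\<close>

lemma linear_vert_J: "linear vert_J"
  by (rule linearI) (auto simp: vert_J_def vec_eq_iff algebra_simps)

lemma vert_J_vert_J [simp]: "vert_J (vert_J a) = - a"
  by (simp add: vert_J_def vec_eq_iff)

lemma sum_UNIV_Plus: "(\<Sum>k\<in>UNIV. f k) = (\<Sum>a\<in>UNIV. f (Inl a)) + (\<Sum>a\<in>UNIV. f (Inr a))"
  for f :: "'a::finite + 'b::finite \<Rightarrow> 'c::comm_monoid_add"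
  unfolding UNIV_Plus_UNIV[symmetric] by (subst sum.Plus) auto

lemma real_frame_expansion: "(\<Sum>k\<in>UNIV. real_coord k a *\<^sub>R real_frame k) = a"
proof -
  have "(\<Sum>k\<in>UNIV. real_coord k a *\<^sub>R real_frame k) $ i = a $ i" for i
  proof -
    have "(\<Sum>k\<in>UNIV. real_coord k a *\<^sub>R real_frame k) $ i =
      (\<Sum>k\<in>UNIV. if k = i then complex_of_real (Re (a $ k)) else 0)
      + (\<Sum>k\<in>UNIV. if k = i then \<i> * complex_of_real (Im (a $ k)) else 0)"
      unfolding sum_UNIV_Plus vector_add_component sum_component
      by (intro arg_cong2[where f="(+)"] sum.cong refl) (auto simp: axis_def complex_eq_iff)
    then show ?thesis by (simp add: complex_eq_iff)
  qed
  then show ?thesis by (simp add: vec_eq_iff)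
qed

lemma linear_real_frame:
  fixes f :: "complex^'n::finite \<Rightarrow> 'b::real_vector"
  assumes "linear f"
  shows "f a = (\<Sum>k\<in>UNIV. real_coord k a *\<^sub>R f (real_frame k))"
  using linear_sum[OF assms, of "\<lambda>k. real_coord k a *\<^sub>R real_frame k" UNIV] linear_scale[OF assms]
  by (simp add: real_frame_expansion)

lemma real_coord_sum_frame:
  "real_coord j (\<Sum>k\<in>UNIV. c k *\<^sub>R real_frame k) = c j"
proof -
  have *: "(\<Sum>k\<in>UNIV. c k *\<^sub>R real_frame k) $ i = Complex (c (Inl i)) (c (Inr i))" for i
  proof -
    have "(\<Sum>k\<in>UNIV. c k *\<^sub>R real_frame k) $ i =
      (\<Sum>k\<in>UNIV. if k = i then complex_of_real (c (Inl k)) else 0)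
      + (\<Sum>k\<in>UNIV. if k = i then \<i> * complex_of_real (c (Inr k)) else 0)"
      unfolding sum_UNIV_Plus vector_add_component sum_component
      by (intro arg_cong2[where f="(+)"] sum.cong refl) (auto simp: axis_def complex_eq_iff)
    then show ?thesis by (simp add: complex_eq_iff)
  qed
  show ?thesis by (cases j) (simp_all only: real_coord.simps *, simp_all)
qed

section \<open>The fibre Hessian of a Finsler metric in a chart\<close>

text \<open>The chart data of a strongly convex complex Finsler metric with \<open>\<nabla>J = 0\<close>.  Only constant sections
  enter the parallelism condition: on them it says that the connection coefficients commute with
  \<open>J\<close>.\<close>

locale finsler_chart =
  fixes S :: "(complex^'n::finite) set" and G :: "(complex^'n) \<times> (complex^'n) \<Rightarrow> real"
  assumes open_S: "open S"
    and smooth_G: "smooth_on (S \<times> (UNIV - {0})) G"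
    and G_scale: "\<And>z v a. z \<in> S \<Longrightarrow> G (z, a *s v) = (cmod a)\<^sup>2 * G (z, v)"
    and fund_tensor_pos: "\<And>p \<xi>. p \<in> S \<times> (UNIV - {0}) \<Longrightarrow> \<xi> \<noteq> 0 \<Longrightarrow> \<xi> \<bullet> (fund_tensor G p *v \<xi>) > 0"
    and nabla_J: "\<And>p X a. p \<in> S \<times> (UNIV - {0}) \<Longrightarrow>
      cartan_nabla G p X (\<lambda>_. vert_J a) = vert_J (cartan_nabla G p X (\<lambda>_. a))"
begin

definition \<Omega> :: "((complex^'n) \<times> (complex^'n)) set" where "\<Omega> = S \<times> (UNIV - {0})"

lemma open_\<Omega>: "open \<Omega>"
  unfolding \<Omega>_def by (intro open_Times open_S) auto

lemma smooth: "smooth_on \<Omega> G"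
  using smooth_G unfolding \<Omega>_def .

definition hess :: "(complex^'n) \<times> (complex^'n) \<Rightarrow> complex^'n \<Rightarrow> complex^'n \<Rightarrow> real" where
  "hess p a b = ddir (0, a) (ddir (0, b) G) p"

definition third :: "(complex^'n) \<times> (complex^'n) \<Rightarrow> complex^'n \<Rightarrow> complex^'n \<Rightarrow> complex^'n \<Rightarrow> real" where
  "third p a b c = ddir (0, a) (ddir (0, b) (ddir (0, c) G)) p"

lemmas smooth_ddir1 = smooth_on_ddir[OF smooth]
lemmas smooth_ddir2 = smooth_on_ddir[OF smooth_ddir1]

lemma linear_ddir_snd: "smooth_on \<Omega> f \<Longrightarrow> p \<in> \<Omega> \<Longrightarrow> linear (\<lambda>a. ddir (0, a) f p)"
  using linear_compose[OF _ ddir_linear[OF smooth_on_differentiable], of "\<lambda>a. (0, a)" \<Omega> f p]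
  by (simp add: comp_def linear_iff)

lemma hess_sym: "p \<in> \<Omega> \<Longrightarrow> hess p a b = hess p b a"
  unfolding hess_def by (rule ddir_commute[OF open_\<Omega> _ smooth])

lemma linear_hess1: "p \<in> \<Omega> \<Longrightarrow> linear (\<lambda>a. hess p a b)"
  unfolding hess_def by (rule linear_ddir_snd[OF smooth_ddir1])

lemma linear_hess2: "p \<in> \<Omega> \<Longrightarrow> linear (\<lambda>b. hess p a b)"
  using linear_hess1[of p a] hess_sym[of p a] by presburger

lemma third_sym12: "p \<in> \<Omega> \<Longrightarrow> third p a b c = third p b a c"
  unfolding third_def by (rule ddir_commute[OF open_\<Omega> _ smooth_ddir1])

lemma third_hess: "third p a b c = ddir (0, a) (\<lambda>q. hess q b c) p"
  by (simp add: third_def hess_def)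

lemma third_sym23: "p \<in> \<Omega> \<Longrightarrow> third p a b c = third p a c b"
  unfolding third_hess by (rule ddir_cong[OF open_\<Omega>]) (auto simp: hess_sym)

lemma linear_third1: "p \<in> \<Omega> \<Longrightarrow> linear (\<lambda>a. third p a b c)"
  unfolding third_def by (rule linear_ddir_snd[OF smooth_ddir2])

lemma linear_third2: "p \<in> \<Omega> \<Longrightarrow> linear (\<lambda>b. third p a b c)"
  using linear_third1[of p a c] third_sym12[of p a _ c] by presburger

lemma linear_third3: "p \<in> \<Omega> \<Longrightarrow> linear (\<lambda>c. third p a b c)"
  using linear_third2[of p a b] third_sym23[of p a b] by presburger

lemma dy_eq_ddir: "dy j f = ddir (0, real_frame j) f"
  by (rule ext) (simp add: dy_def)

lemma dy_hess: "dy j (dy k G) p = hess p (real_frame j) (real_frame k)"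
  by (simp add: dy_eq_ddir hess_def)

lemma dy_third: "dy j (dy k (dy l G)) p = third p (real_frame j) (real_frame k) (real_frame l)"
  by (simp add: dy_eq_ddir third_def)

lemma fund_tensor_hess: "fund_tensor G p $ j $ k = hess p (real_frame j) (real_frame k) / 2"
  by (simp add: fund_tensor_def dy_hess)

lemma fund_inv_right:
  assumes "p \<in> \<Omega>"
  shows "(\<Sum>k\<in>UNIV. fund_tensor G p $ s $ k * fund_inv G k t p) = (if s = t then 1 else 0)"
proof -
  let ?g = "fund_tensor G p"
  have "\<xi> = 0" if "?g *v \<xi> = 0" for \<xi>
    using fund_tensor_pos[of p \<xi>] that assms by (force simp: \<Omega>_def)
  then have "\<exists>B. B ** ?g = mat 1"
    using matrix_left_invertible_ker by blast
  then have "invertible ?g" using invertible_left_inverse by blast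
  then have "?g ** matrix_inv ?g = mat 1"
    unfolding matrix_inv_def invertible_def by (rule someI2_ex) auto
  then have "(?g ** matrix_inv ?g) $ s $ t = (mat 1 :: real^('n+'n)^('n+'n)) $ s $ t" by simp
  then show ?thesis by (simp add: matrix_matrix_mult_def mat_def fund_inv_def)
qed

text \<open>Raising an index with the inverse of the fundamental tensor \<open>hess / 2\<close>; the factor 2 is the
  normalisation of that tensor.\<close>

lemma hess_raise_index:
  assumes p: "p \<in> \<Omega>"
    and K: "K = (\<Sum>k\<in>UNIV. (\<Sum>t\<in>UNIV. fund_inv G k t p * c t) *\<^sub>R real_frame k)"
  shows "hess p a K = 2 * (\<Sum>s\<in>UNIV. real_coord s a * c s)"
proof -
  have "hess p (real_frame s) K = 2 * c s" for s
  proof -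
    have "hess p (real_frame s) K = (\<Sum>k\<in>UNIV. (\<Sum>t\<in>UNIV. fund_inv G k t p * c t) * hess p (real_frame s) (real_frame k))"
      using linear_real_frame[OF linear_hess2[OF p], of _ K]
      by (simp add: K real_coord_sum_frame)
    also have "\<dots> = (\<Sum>k\<in>UNIV. \<Sum>t\<in>UNIV. 2 * c t * (fund_tensor G p $ s $ k * fund_inv G k t p))"
      unfolding sum_distrib_right fund_tensor_hess by (intro sum.cong refl) simp
    also have "\<dots> = (\<Sum>t\<in>UNIV. 2 * c t * (\<Sum>k\<in>UNIV. fund_tensor G p $ s $ k * fund_inv G k t p))"
      unfolding sum_distrib_left by (rule sum.swap)
    also have "\<dots> = 2 * c s"
      by (simp add: fund_inv_right[OF p] if_distrib cong: if_cong)
    finally show ?thesis .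
  qed
  then show ?thesis
    using linear_real_frame[OF linear_hess1[OF p], of a K] by (simp add: sum_distrib_left mult.left_commute)
qed

lemma hess_pos:
  assumes p: "p \<in> \<Omega>" and a: "a \<noteq> 0"
  shows "hess p a a > 0"
proof -
  define \<xi> :: "real^('n+'n)" where "\<xi> = (\<chi> k. real_coord k a)"
  have "\<xi> \<noteq> 0"
  proof
    assume "\<xi> = 0"
    then have "real_coord k a = 0" for k by (simp add: \<xi>_def vec_eq_iff)
    then show False using real_frame_expansion[of a] a by simp
  qed
  have *: "(fund_tensor G p *v \<xi>) $ s = hess p (real_frame s) a / 2" for s
    using linear_real_frame[OF linear_hess2[OF p], of _ a]
    by (simp add: matrix_vector_mult_def fund_tensor_hess \<xi>_def sum_divide_distrib mult.commute)
  then have "\<xi> \<bullet> (fund_tensor G p *v \<xi>) = hess p a a / 2"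
    using linear_real_frame[OF linear_hess1[OF p], of a a] unfolding inner_vec_def *
    by (simp add: \<xi>_def sum_divide_distrib)
  then show ?thesis using fund_tensor_pos[of p \<xi>] \<open>\<xi> \<noteq> 0\<close> p by (simp add: \<Omega>_def)
qed

lemma hess_nondegenerate:
  assumes "p \<in> \<Omega>" and "\<And>a. hess p a K = 0"
  shows "K = 0"
  using hess_pos[OF assms(1), of K] assms(2) by force

text \<open>Both families of connection coefficients arise from a trilinear form \<open>Q\<close> by raising its first index.
  This lemma passes from the coefficients to the invariant description of the connection, so that no
  index computation is needed afterwards.\<close>

lemma hess_connection:
  assumes p: "p \<in> \<Omega>"
    and lin: "\<And>b c. linear (\<lambda>t. Q t b c)" "\<And>t c. linear (\<lambda>b. Q t b c)" "\<And>t b. linear (\<lambda>c. Q t b c)"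
    and \<Gamma>: "\<And>k j l. \<Gamma> k j l = (\<Sum>t\<in>UNIV. fund_inv G k t p * Q (real_frame t) (real_frame j) (real_frame l))"
  shows "hess p c (\<Sum>k\<in>UNIV. (\<Sum>j\<in>UNIV. \<Sum>l\<in>UNIV. real_coord j a * (real_coord l b * \<Gamma> k j l)) *\<^sub>R real_frame k)
    = 2 * Q c a b"
proof -
  have Q: "Q t a b = (\<Sum>j\<in>UNIV. \<Sum>l\<in>UNIV. real_coord j a * (real_coord l b * Q t (real_frame j) (real_frame l)))" for t
    using linear_real_frame[OF lin(2), of t a b] linear_real_frame[OF lin(3), of t _ b]
    by (simp add: sum_distrib_left)
  have "(\<Sum>j\<in>UNIV. \<Sum>l\<in>UNIV. real_coord j a * (real_coord l b * \<Gamma> k j l))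
      = (\<Sum>t\<in>UNIV. fund_inv G k t p * Q (real_frame t) a b)" for k
  proof -
    have "(\<Sum>j\<in>UNIV. \<Sum>l\<in>UNIV. real_coord j a * (real_coord l b * \<Gamma> k j l))
      = (\<Sum>j\<in>UNIV. \<Sum>l\<in>UNIV. \<Sum>t\<in>UNIV. fund_inv G k t p * (real_coord j a * (real_coord l b * Q (real_frame t) (real_frame j) (real_frame l))))"
      unfolding \<Gamma> sum_distrib_left by (intro sum.cong refl) (simp add: mult_ac)
    also have "\<dots> = (\<Sum>j\<in>UNIV. \<Sum>t\<in>UNIV. \<Sum>l\<in>UNIV. fund_inv G k t p * (real_coord j a * (real_coord l b * Q (real_frame t) (real_frame j) (real_frame l))))"
      by (intro sum.cong refl sum.swap)
    also have "\<dots> = (\<Sum>t\<in>UNIV. \<Sum>j\<in>UNIV. \<Sum>l\<in>UNIV. fund_inv G k t p * (real_coord j a * (real_coord l b * Q (real_frame t) (real_frame j) (real_frame l))))"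
      by (rule sum.swap)
    also have "\<dots> = (\<Sum>t\<in>UNIV. fund_inv G k t p * Q (real_frame t) a b)"
      by (subst Q) (simp add: sum_distrib_left)
    finally show ?thesis .
  qed
  then have "hess p c (\<Sum>k\<in>UNIV. (\<Sum>j\<in>UNIV. \<Sum>l\<in>UNIV. real_coord j a * (real_coord l b * \<Gamma> k j l)) *\<^sub>R real_frame k)
      = 2 * (\<Sum>s\<in>UNIV. real_coord s c * Q (real_frame s) a b)"
    by (intro hess_raise_index[OF p]) simp
  also have "\<dots> = 2 * Q c a b"
    using linear_real_frame[OF lin(1), of c a b] by simp
  finally show ?thesis .
qed

section \<open>Parallelism of J in vertical directions\<close>

definition vert_nabla :: "(complex^'n) \<times> (complex^'n) \<Rightarrow> complex^'n \<Rightarrow> complex^'n \<Rightarrow> complex^'n" where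
  "vert_nabla p a b = cartan_nabla G p (0, b) (\<lambda>_. a)"

lemma real_coord_zero: "real_coord k (0::complex^'n) = 0"
  by (cases k) auto

lemma hess_vert_nabla:
  assumes p: "p \<in> \<Omega>"
  shows "hess p c (vert_nabla p a b) = third p a b c / 2"
proof -
  define Q where "Q t a b = third p a b t / 4" for t a b
  have "linear (\<lambda>t. Q t b c)" "linear (\<lambda>t. Q b t c)" "linear (\<lambda>t. Q b c t)" for b c
    using linear_third1[OF p] linear_third2[OF p] linear_third3[OF p]
    by (simp_all add: Q_def linear_iff add_divide_distrib)
  from hess_connection[OF p this, where \<Gamma> = "\<lambda>k j l. cartan_ver G k j l p", of c a b]
  have "hess p c (vert_nabla p a b) = 2 * Q c a b"
    by (simp add: vert_nabla_def cartan_nabla_def ver_comp_def real_coord_zero cartan_ver_def dy_third Q_def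
      sum_divide_distrib)
  then show ?thesis by (simp add: Q_def)
qed

lemma vert_nabla_J: "p \<in> \<Omega> \<Longrightarrow> vert_nabla p (vert_J a) b = vert_J (vert_nabla p a b)"
  unfolding vert_nabla_def using nabla_J by (simp add: \<Omega>_def)

text \<open>Homogeneity along the real ray and along the tangent to the circle through \<open>v\<close>:
  \<open>|1 + t|\<^sup>2\<close> has derivative 2 at \<open>t = 0\<close>, whereas \<open>|1 + \<i> t|\<^sup>2 = 1 + t\<^sup>2\<close> has derivative 0.\<close>

lemma euler_radial:
  assumes "(z, v) \<in> \<Omega>"
  shows "ddir (0, v) G (z, v) = 2 * G (z, v)"
proof -
  have d: "(G has_derivative (\<lambda>u. ddir u G (z, v))) (at (z, v))"
    using smooth_on_differentiable[OF smooth assms] frechet_derivative_works by blast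
  have 1: "((\<lambda>t::real. (z, v + t *\<^sub>R v)) has_derivative (\<lambda>h. (0, h *\<^sub>R v))) (at 0)"
    by (auto intro!: derivative_eq_intros)
  have "((\<lambda>t::real. G (z, v + t *\<^sub>R v)) has_derivative (\<lambda>h. ddir (0, h *\<^sub>R v) G (z, v))) (at 0)"
    using diff_chain_at[OF 1, of G] d by (simp add: comp_def)
  moreover have "G (z, v + t *\<^sub>R v) = (1 + t)\<^sup>2 * G (z, v)" for t :: real
  proof -
    have "v + t *\<^sub>R v = complex_of_real (1 + t) *s v"
      by (simp add: vec_eq_iff complex_eq_iff algebra_simps)
    then show ?thesis using G_scale[of z "complex_of_real (1 + t)" v] assms
      by (simp add: \<Omega>_def norm_of_real del: of_real_add)
  qed
  ultimately have 2: "((\<lambda>t::real. (1 + t)\<^sup>2 * G (z, v)) has_derivative (\<lambda>h. ddir (0, h *\<^sub>R v) G (z, v))) (at 0)"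
    by simp
  have "((\<lambda>t::real. (1 + t)\<^sup>2 * G (z, v)) has_derivative (\<lambda>h. h * (2 * G (z, v)))) (at 0)"
    by (auto intro!: derivative_eq_intros)
  from fun_cong[OF has_derivative_unique[OF 2 this], of 1] show ?thesis by simp
qed

lemma euler_rotation:
  assumes "(z, v) \<in> \<Omega>"
  shows "ddir (0, vert_J v) G (z, v) = 0"
proof -
  have d: "(G has_derivative (\<lambda>u. ddir u G (z, v))) (at (z, v))"
    using smooth_on_differentiable[OF smooth assms] frechet_derivative_works by blast
  have 1: "((\<lambda>t::real. (z, v + t *\<^sub>R vert_J v)) has_derivative (\<lambda>h. (0, h *\<^sub>R vert_J v))) (at 0)"
    by (auto intro!: derivative_eq_intros)
  have "((\<lambda>t::real. G (z, v + t *\<^sub>R vert_J v)) has_derivative (\<lambda>h. ddir (0, h *\<^sub>R vert_J v) G (z, v))) (at 0)"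
    using diff_chain_at[OF 1, of G] d by (simp add: comp_def)
  moreover have "G (z, v + t *\<^sub>R vert_J v) = (1 + t\<^sup>2) * G (z, v)" for t :: real
  proof -
    have "v + t *\<^sub>R vert_J v = Complex 1 t *s v"
      by (simp add: vec_eq_iff vert_J_def complex_eq_iff)
    moreover have "(cmod (Complex 1 t))\<^sup>2 = 1 + t\<^sup>2" by (simp add: cmod_power2)
    ultimately show ?thesis using G_scale[of z "Complex 1 t" v] assms
      by (simp add: \<Omega>_def)
  qed
  ultimately have 2: "((\<lambda>t::real. (1 + t\<^sup>2) * G (z, v)) has_derivative (\<lambda>h. ddir (0, h *\<^sub>R vert_J v) G (z, v))) (at 0)"
    by simp
  have "((\<lambda>t::real. (1 + t\<^sup>2) * G (z, v)) has_derivative (\<lambda>h. 0)) (at 0)"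
    by (auto intro!: derivative_eq_intros)
  from fun_cong[OF has_derivative_unique[OF 2 this], of 1] show ?thesis by simp
qed

text \<open>The case of \<open>ddir_along_field\<close> that is used for Euler identities: a direction that depends linearly on
  the fibre point.\<close>

lemma ddir_radial:
  assumes L: "linear L" and f: "smooth_on \<Omega> f" and p: "p \<in> \<Omega>"
  shows "ddir (0, a) (\<lambda>q. ddir (0, L (snd q)) f q) p
       = ddir (0, a) (ddir (0, L (snd p)) f) p + ddir (0, L a) f p"
proof -
  have bl: "bounded_linear (\<lambda>q::(complex^'n) \<times> (complex^'n). ((0::complex^'n), L (snd q)))"
    using L by (intro bounded_linear_Pair bounded_linear_zero linear_linear[THEN iffD1]
      bounded_linear_compose[of L snd, unfolded comp_def]) (auto simp: linear_conv_bounded_linear bounded_linear_snd)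
  then have d: "((\<lambda>q. ((0::complex^'n), L (snd q))) has_derivative (\<lambda>q. (0, L (snd q)))) (at p)"
    by (rule bounded_linear_imp_has_derivative)
  show ?thesis
    using ddir_along_field[OF open_\<Omega> p f, of "\<lambda>q. (0, L (snd q))" "(0, a)"] d
    by (auto simp: ddir_eq differentiable_def)
qed

lemma hess_radial:
  assumes p: "p \<in> \<Omega>"
  shows "hess p a (snd p) = ddir (0, a) G p"
proof -
  have "ddir (0, a) (\<lambda>q. ddir (0, snd q) G q) p = ddir (0, a) (\<lambda>q. 2 * G q) p"
    by (rule ddir_cong[OF open_\<Omega> p]) (use euler_radial in auto)
  also have "\<dots> = 2 * ddir (0, a) G p"
    by (rule ddir_bounded_linear[OF bounded_linear_mult_right smooth_on_differentiable[OF smooth p]])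
  finally show ?thesis using ddir_radial[OF linear_ident smooth p, where a = a]
    by (simp add: hess_def)
qed

lemma G_hess: "p \<in> \<Omega> \<Longrightarrow> G p = hess p (snd p) (snd p) / 2"
  using euler_radial[of "fst p" "snd p"] hess_radial[of p "snd p"] by simp

lemma third_radial:
  assumes p: "p \<in> \<Omega>"
  shows "third p b a (snd p) = 0"
proof -
  have "ddir (0, b) (\<lambda>q. ddir (0, snd q) (ddir (0, a) G) q) p = ddir (0, b) (ddir (0, a) G) p"
  proof (rule ddir_cong[OF open_\<Omega> p])
    fix q assume "q \<in> \<Omega>"
    then show "ddir (0, snd q) (ddir (0, a) G) q = ddir (0, a) G q"
      using hess_radial[of q a] hess_sym[of q "snd q" a] by (simp add: hess_def)
  qed
  then show ?thesis using ddir_radial[OF linear_ident smooth_ddir1 p, where a = b] third_sym23[OF p, of b a]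
    by (simp add: third_def)
qed

lemma hess_radial_J:
  assumes p: "p \<in> \<Omega>"
  shows "hess p a (vert_J (snd p)) = - ddir (0, vert_J a) G p"
proof -
  have "ddir (0, a) (\<lambda>q. ddir (0, vert_J (snd q)) G q) p = ddir (0, a) (\<lambda>q. 0) p"
    by (rule ddir_cong[OF open_\<Omega> p]) (use euler_rotation in auto)
  then show ?thesis using ddir_radial[OF linear_vert_J smooth p, where a = a]
    by (simp add: hess_def)
qed

text \<open>The second derivative of \<open>euler_rotation\<close>.  The right hand side measures the failure of \<open>hess\<close> to be
  \<open>J\<close>-invariant.\<close>

lemma third_radial_J:
  assumes p: "p \<in> \<Omega>"
  shows "third p b a (vert_J (snd p)) = - (hess p a (vert_J b) + hess p b (vert_J a))"
proof -
  have "ddir (0, b) (\<lambda>q. ddir (0, vert_J (snd q)) (ddir (0, a) G) q) p = ddir (0, b) (\<lambda>q. - ddir (0, vert_J a) G q) p"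
  proof (rule ddir_cong[OF open_\<Omega> p])
    fix q assume "q \<in> \<Omega>"
    then show "ddir (0, vert_J (snd q)) (ddir (0, a) G) q = - ddir (0, vert_J a) G q"
      using hess_radial_J[of q a] hess_sym[of q "vert_J (snd q)" a] by (simp add: hess_def)
  qed
  also have "\<dots> = - ddir (0, b) (ddir (0, vert_J a) G) p"
    by (rule ddir_bounded_linear[OF bounded_linear_minus[OF bounded_linear_ident] smooth_on_differentiable[OF smooth_ddir1 p]])
  finally show ?thesis using ddir_radial[OF linear_vert_J smooth_ddir1 p, where a = b] third_sym23[OF p, of b a] hess_sym[OF p, of "vert_J b" a]
    by (simp add: third_def hess_def)
qed

lemma vert_nabla_radial:
  assumes p: "p \<in> \<Omega>"
  shows "vert_nabla p (snd p) b = 0"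
proof (rule hess_nondegenerate[OF p])
  fix a
  show "hess p a (vert_nabla p (snd p) b) = 0"
    using hess_vert_nabla[OF p, of a "snd p" b] third_radial[OF p, of b a]
      third_sym12[OF p, of "snd p" b a] third_sym23[OF p, of b "snd p" a] by simp
qed

text \<open>This is where parallelism in vertical directions enters: \<open>vert_nabla\<close> vanishes on the radial direction, hence by \<open>J\<close>-linearity on
  its rotation, and \<open>third_radial_J\<close> has zero left hand side.\<close>

lemma hess_J:
  assumes p: "p \<in> \<Omega>"
  shows "hess p a (vert_J b) = - hess p (vert_J a) b"
proof -
  have "vert_nabla p (vert_J (snd p)) b = 0"
    using vert_nabla_J[OF p] vert_nabla_radial[OF p] linear_0[OF linear_vert_J] by simp
  then have "third p (vert_J (snd p)) b a = 0"
    using hess_vert_nabla[OF p, of a "vert_J (snd p)" b] linear_0[OF linear_hess2[OF p]] by simp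
  then have "third p b a (vert_J (snd p)) = 0"
    using third_sym12[OF p] third_sym23[OF p] by metis
  then show ?thesis using third_radial_J[OF p, of b a] hess_sym[OF p, of b "vert_J a"] by linarith
qed

text \<open>Skewness of \<open>J\<close> passes from \<open>hess\<close> to its derivative.  Moving \<open>J\<close> once around the three slots of the
  symmetric form \<open>third\<close> costs three sign changes, so \<open>third(x, a, Jb)\<close> equals its own negative.\<close>

lemma third_zero:
  assumes p: "p \<in> \<Omega>"
  shows "third p a b c = 0"
proof -
  have J: "third p x a (vert_J b) = - third p x (vert_J a) b" for x a b
  proof -
    have "third p x a (vert_J b) = ddir (0, x) (\<lambda>q. - hess q (vert_J a) b) p"
      unfolding third_hess by (rule ddir_cong[OF open_\<Omega> p]) (simp add: hess_J)
    also have "\<dots> = - third p x (vert_J a) b"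
      unfolding third_hess hess_def
      by (rule ddir_bounded_linear[OF bounded_linear_minus[OF bounded_linear_ident] smooth_on_differentiable[OF smooth_ddir2 p]])
    finally show ?thesis .
  qed
  have "third p x a (vert_J b) = 0" for x a b
  proof -
    have "third p x a (vert_J b) = - third p x (vert_J a) b" by (rule J)
    also have "\<dots> = - third p b x (vert_J a)" using third_sym12[OF p] third_sym23[OF p] by metis
    also have "\<dots> = third p b (vert_J x) a" using J[of b x a] by simp
    also have "\<dots> = third p a b (vert_J x)" using third_sym12[OF p] third_sym23[OF p] by metis
    also have "\<dots> = - third p a (vert_J b) x" by (rule J)
    also have "\<dots> = - third p x a (vert_J b)" using third_sym12[OF p] third_sym23[OF p] by metis
    finally show ?thesis by simp
  qed
  from this[of a b "vert_J c"] linear_neg[OF linear_third3[OF p]] show ?thesis by simp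
qed

text \<open>A fixed nonzero fibre vector at which the Hessian is evaluated; by \<open>hess_B\<close> the choice is
  immaterial.\<close>

definition v0 :: "complex^'n" where "v0 = (\<chi> i. 1)"

lemma v0_nonzero: "v0 \<noteq> 0" by (simp add: v0_def vec_eq_iff)

definition B :: "complex^'n \<Rightarrow> complex^'n \<Rightarrow> complex^'n \<Rightarrow> real" where
  "B z a b = hess (z, v0) a b / 2"

text \<open>The Hessian is locally constant in \<open>v\<close> by \<open>third_zero\<close>, and the punctured fibre is connected because
  its real dimension is at least 2.\<close>

lemma hess_B:
  assumes p: "(z, v) \<in> \<Omega>"
  shows "hess (z, v) a b = 2 * B z a b"
proof -
  have "hess (z, v) a b = hess (z, v0) a b"
  proof (rule has_derivative_zero_unique_connected[of "UNIV - {0}" "\<lambda>v. hess (z, v) a b"])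
    show "open (UNIV - {0 :: complex^'n})" by auto
    have "2 \<le> DIM(complex^'n)" by simp
    then show "connected (UNIV - {0 :: complex^'n})"
      using connected_punctured_universe[of "0 :: complex^'n"] by (simp add: Compl_eq_Diff_UNIV)
    fix v :: "complex^'n" assume "v \<in> UNIV - {0}"
    then have q: "(z, v) \<in> \<Omega>" using p by (auto simp: \<Omega>_def)
    have 1: "((\<lambda>v. (z, v)) has_derivative (\<lambda>u. (0, u))) (at v)"
      by (auto intro!: derivative_eq_intros)
    have "((\<lambda>q. hess q a b) has_derivative (\<lambda>u. ddir u (\<lambda>q. hess q a b) (z, v))) (at (z, v))"
      unfolding hess_def using smooth_on_differentiable[OF smooth_ddir2 q] frechet_derivative_works by blast
    from diff_chain_at[OF 1 this]
    have "((\<lambda>v. hess (z, v) a b) has_derivative (\<lambda>u. ddir (0, u) (\<lambda>q. hess q a b) (z, v))) (at v)"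
      by (simp add: comp_def)
    then show "((\<lambda>v. hess (z, v) a b) has_derivative (\<lambda>x. 0)) (at v)"
      using third_zero[OF q] unfolding third_hess by simp
  qed (use p v0_nonzero in \<open>auto simp: \<Omega>_def\<close>)
  then show ?thesis by (simp add: B_def)
qed

end

section \<open>Parallelism of J in horizontal directions\<close>

lemma linear_add_scale:
  assumes "linear f"
  shows "f (a + b) = f a + f b" "f (r *\<^sub>R a) = r *\<^sub>R f a"
  using assms by (simp_all add: linear_iff)

context finsler_chart
begin

lemma in_\<Omega>: "z \<in> S \<Longrightarrow> (z, v0) \<in> \<Omega>"
  using v0_nonzero by (simp add: \<Omega>_def)

lemma smooth_B: "smooth_on S (\<lambda>z. B z a b)"
  unfolding B_def hess_def
  by (rule smooth_on_slice[OF open_S, of "UNIV - {0}"],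
      rule smooth_on_bounded_linear[where L="\<lambda>x. x / 2"])
    (use smooth_ddir2 open_\<Omega> v0_nonzero in \<open>auto simp: \<Omega>_def bounded_linear_divide\<close>)

lemma B_diff: "z \<in> S \<Longrightarrow> (\<lambda>z. B z a b) differentiable (at z)"
  by (rule smooth_on_differentiable[OF smooth_B])

lemma B_sym: "z \<in> S \<Longrightarrow> B z a b = B z b a"
  unfolding B_def using hess_sym in_\<Omega> by simp

lemma B_J: "z \<in> S \<Longrightarrow> B z a (vert_J b) = - B z (vert_J a) b"
  unfolding B_def using hess_J in_\<Omega> by simp

lemma B_lin: "z \<in> S \<Longrightarrow> B z (a + a') b = B z a b + B z a' b" "z \<in> S \<Longrightarrow> B z (r *\<^sub>R a) b = r * B z a b"
  unfolding B_def using linear_add_scale[OF linear_hess1[OF in_\<Omega>]] by (auto simp: add_divide_distrib)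

definition dB :: "complex^'n \<Rightarrow> complex^'n \<Rightarrow> complex^'n \<Rightarrow> complex^'n \<Rightarrow> real" where
  "dB z x a b = ddir x (\<lambda>z. B z a b) z"

lemma linear_dB1: "z \<in> S \<Longrightarrow> linear (\<lambda>x. dB z x a b)"
  unfolding dB_def by (rule ddir_linear[OF B_diff])

lemma dB_sym: "z \<in> S \<Longrightarrow> dB z x a b = dB z x b a"
  unfolding dB_def by (rule ddir_cong[OF open_S]) (auto intro: B_sym)

lemma dB_J:
  assumes z: "z \<in> S"
  shows "dB z x a (vert_J b) = - dB z x (vert_J a) b"
proof -
  have "dB z x a (vert_J b) = ddir x (\<lambda>z. - B z (vert_J a) b) z"
    unfolding dB_def by (rule ddir_cong[OF open_S z]) (rule B_J)
  also have "\<dots> = - dB z x (vert_J a) b"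
    unfolding dB_def by (rule ddir_bounded_linear[OF bounded_linear_minus[OF bounded_linear_ident] B_diff[OF z]])
  finally show ?thesis .
qed

lemma linear_dB2:
  assumes z: "z \<in> S"
  shows "linear (\<lambda>a. dB z x a b)"
proof (rule linearI)
  fix a a' r
  have "dB z x (a + a') b = ddir x (\<lambda>z. B z a b + B z a' b) z"
    unfolding dB_def by (rule ddir_cong[OF open_S z]) (rule B_lin)
  then show "dB z x (a + a') b = dB z x a b + dB z x a' b"
    unfolding dB_def by (simp add: ddir_add B_diff[OF z])
  have "dB z x (r *\<^sub>R a) b = ddir x (\<lambda>z. r * B z a b) z"
    unfolding dB_def by (rule ddir_cong[OF open_S z]) (rule B_lin)
  also have "\<dots> = r * dB z x a b"
    unfolding dB_def by (rule ddir_bounded_linear[OF bounded_linear_mult_right B_diff[OF z]])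
  finally show "dB z x (r *\<^sub>R a) b = r *\<^sub>R dB z x a b" by simp
qed

lemma linear_dB3: "z \<in> S \<Longrightarrow> linear (\<lambda>b. dB z x a b)"
  using linear_dB2[of z x a] dB_sym[of z x a] by presburger

text \<open>The fundamental tensor is constant along the fibres, so the nonlinear connection drops out of its
  adapted derivative.\<close>

lemma delta_x_fund_tensor:
  assumes z: "z \<in> S"
  shows "delta_x G l (\<lambda>q. fund_tensor G q $ s $ j) (z, v0) = dB z (real_frame l) (real_frame s) (real_frame j)"
proof -
  let ?f = "\<lambda>q. fund_tensor G q $ s $ j"
  note p = in_\<Omega>[OF z]
  have f: "?f = (\<lambda>q. hess q (real_frame s) (real_frame j) / 2)"
    by (simp add: fund_tensor_hess)
  have df: "?f differentiable (at (z, v0))"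
    unfolding f hess_def
    by (rule differentiable_bounded_linear[OF bounded_linear_divide smooth_on_differentiable[OF smooth_ddir2 p]])
  have "dy k ?f (z, v0) = 0" for k
  proof -
    have "dy k ?f (z, v0) = ddir (0, real_frame k) (\<lambda>q. hess q (real_frame s) (real_frame j)) (z, v0) / 2"
      unfolding dy_def f hess_def
      by (rule ddir_bounded_linear[OF bounded_linear_divide smooth_on_differentiable[OF smooth_ddir2 p]])
    then show ?thesis using third_zero[OF p] unfolding third_hess by simp
  qed
  moreover have "dx l ?f (z, v0) = dB z (real_frame l) (real_frame s) (real_frame j)"
  proof -
    have "dx l ?f (z, v0) = ddir (real_frame l) (\<lambda>z. ?f (z, v0)) z"
      unfolding dx_def using ddir_affine_slice(1)[OF df] by simp
    then show ?thesis by (simp add: dB_def B_def fund_tensor_hess)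
  qed
  ultimately show ?thesis by (simp add: delta_x_def)
qed

text \<open>Commutation of \<open>J\<close> with the Levi-Civita symbols of \<open>B\<close>, paired with a vector.  Of the
  three terms of Koszul's formula, the derivative of \<open>B\<close> along \<open>h\<close>, the direction of covariant
  differentiation, cancels by skewness of \<open>J\<close>; the others are the four terms of the identity.\<close>

lemma kaehler_real:
  assumes z: "z \<in> S"
  shows "dB z (vert_J y) u h + dB z y (vert_J u) h = dB z (vert_J u) y h + dB z u (vert_J y) h"
proof -
  note p = in_\<Omega>[OF z]
  \<comment> \<open>Koszul's formula: \<open>Q\<close> is the Levi-Civita symbol of the first kind, with \<open>t\<close> the lowered upper index.\<close>
  define Q where "Q t a b = (dB z b t a - dB z t a b + dB z a b t) / 2" for t a b
  define K where "K a = cartan_nabla G (z, v0) (h, 0) (\<lambda>_. a)" for a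
  have lin: "linear (\<lambda>t. Q t b c)" "linear (\<lambda>t. Q b t c)" "linear (\<lambda>t. Q b c t)" for b c
    using linear_add_scale[OF linear_dB1[OF z]] linear_add_scale[OF linear_dB2[OF z]] linear_add_scale[OF linear_dB3[OF z]]
    by (simp_all add: Q_def linear_iff field_simps)
  have ver: "cartan_ver G k j l (z, v0) = 0" for k j l
    by (simp add: cartan_ver_def dy_third third_zero[OF p])
  have hor: "cartan_hor G k j l (z, v0) =
      (\<Sum>t\<in>UNIV. fund_inv G k t (z, v0) * Q (real_frame t) (real_frame j) (real_frame l))" for k j l
    by (simp add: cartan_hor_def delta_x_fund_tensor[OF z] Q_def)
  have hK: "hess (z, v0) c (K a) = 2 * Q c a h" for a c
    using hess_connection[OF p lin hor, of c a h]
    by (simp add: K_def cartan_nabla_def ver)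
  have "K (vert_J y) = vert_J (K y)"
    unfolding K_def using nabla_J p by (simp add: \<Omega>_def)
  then have "Q u (vert_J y) h = - Q (vert_J u) y h"
    using hK[of u "vert_J y"] hK[of "vert_J u" y] hess_J[OF p, of u "K y"] by simp
  then show ?thesis
    using dB_J[OF z, of h u y] dB_sym[OF z, of "vert_J y" h u] dB_sym[OF z, of y h "vert_J u"]
    by (simp add: Q_def field_simps)
qed

section \<open>The Hermitian metric and its Kaehler property\<close>

text \<open>The Hermitian form with real part \<open>B\<close>.  The sign of the imaginary part makes it complex linear in the
  first argument and conjugate linear in the second.\<close>

definition hform :: "complex^'n \<Rightarrow> complex^'n \<Rightarrow> complex^'n \<Rightarrow> complex" where
  "hform z a b = Complex (B z a b) (- B z (vert_J a) b)"

definition H :: "complex^'n \<Rightarrow> complex^'n^'n" where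
  "H z = (\<chi> \<mu> \<nu>. hform z (axis \<mu> 1) (axis \<nu> 1))"

lemma hform_cnj: "z \<in> S \<Longrightarrow> hform z b a = cnj (hform z a b)"
  using B_sym[of z a b] B_sym[of z "vert_J b" a] B_J[of z a b]
  by (simp add: hform_def complex_eq_iff)

lemma hform_add: "z \<in> S \<Longrightarrow> hform z (a + a') b = hform z a b + hform z a' b"
  using linear_add[OF linear_vert_J, of a a'] by (simp add: hform_def complex_eq_iff B_lin)

lemma hform_scale:
  assumes z: "z \<in> S"
  shows "hform z (c *s a) b = c * hform z a b"
proof -
  have "c *s a = Re c *\<^sub>R a + Im c *\<^sub>R vert_J a"
    by (simp add: vec_eq_iff vert_J_def complex_eq_iff)
  moreover have "B z (Re c *\<^sub>R vert_J a - Im c *\<^sub>R a) b = Re c * B z (vert_J a) b - Im c * B z a b"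
    using B_lin(1)[OF z, of "Re c *\<^sub>R vert_J a" "(- Im c) *\<^sub>R a" b]
    by (simp add: B_lin(2)[OF z] del: scaleR_minus_left) (simp add: B_lin(2)[OF z])
  ultimately show ?thesis
    by (simp add: hform_def complex_eq_iff B_lin[OF z] linear_add_scale[OF linear_vert_J] algebra_simps)
qed

lemma hform_sum: "z \<in> S \<Longrightarrow> hform z (\<Sum>i\<in>I. c i *s a i) b = (\<Sum>i\<in>I. c i * hform z (a i) b)"
proof (induction I rule: infinite_finite_induct)
  case (insert x F)
  then show ?case by (simp add: hform_add hform_scale)
qed (use hform_scale[of z 0 0 b] in auto)

lemma hform_H:
  assumes z: "z \<in> S"
  shows "hform z a b = (\<Sum>\<mu>\<in>UNIV. \<Sum>\<nu>\<in>UNIV. H z $ \<mu> $ \<nu> * a $ \<mu> * cnj (b $ \<nu>))"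
proof -
  have ex: "a = (\<Sum>\<mu>\<in>UNIV. a $ \<mu> *s axis \<mu> 1)" for a :: "complex^'n"
    by (simp add: basis_expansion)
  have "hform z a b = (\<Sum>\<mu>\<in>UNIV. a $ \<mu> * cnj (hform z b (axis \<mu> 1)))"
    by (subst ex[of a], subst hform_sum[OF z], subst hform_cnj[OF z]) simp
  also have "\<dots> = (\<Sum>\<mu>\<in>UNIV. a $ \<mu> * cnj (\<Sum>\<nu>\<in>UNIV. b $ \<nu> * hform z (axis \<nu> 1) (axis \<mu> 1)))"
    by (subst ex[of b], subst hform_sum[OF z]) simp
  also have "\<dots> = (\<Sum>\<mu>\<in>UNIV. \<Sum>\<nu>\<in>UNIV. H z $ \<mu> $ \<nu> * a $ \<mu> * cnj (b $ \<nu>))"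
    by (simp add: H_def sum_distrib_left hform_cnj[OF z, symmetric] mult_ac)
  finally show ?thesis .
qed

lemma B_pos: "z \<in> S \<Longrightarrow> a \<noteq> 0 \<Longrightarrow> B z a a > 0"
  unfolding B_def using hess_pos in_\<Omega> by simp

lemma B_J_self: "z \<in> S \<Longrightarrow> B z (vert_J a) a = 0"
  using B_J[of z a a] B_sym[of z a "vert_J a"] by simp

lemma G_hform:
  assumes z: "z \<in> S"
  shows "complex_of_real (G (z, v)) = hform z v v"
proof (cases "v = 0")
  case True
  then show ?thesis using G_scale[OF z, of 0 0] hform_scale[OF z, of 0 0 0] by simp
next
  case False
  then have "(z, v) \<in> \<Omega>" using z by (simp add: \<Omega>_def)
  then have "G (z, v) = B z v v" using G_hess hess_B by fastforce
  then show ?thesis using B_J_self[OF z] by (simp add: hform_def complex_eq_iff)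
qed

text \<open>\<open>H\<close> is a finite sum of constant matrices with smooth real coefficients.\<close>

lemma smooth_H: "smooth_on S H"
proof (rule smooth_on_cong[OF open_S])
  let ?M = "\<lambda>x \<mu> \<nu>. axis \<mu> (axis \<nu> x) :: complex^'n^'n"
  show "smooth_on S (\<lambda>z. \<Sum>\<mu>\<in>UNIV. \<Sum>\<nu>\<in>UNIV. B z (axis \<mu> 1) (axis \<nu> 1) *\<^sub>R ?M 1 \<mu> \<nu>
      + B z (vert_J (axis \<mu> 1)) (axis \<nu> 1) *\<^sub>R ?M (- \<i>) \<mu> \<nu>)"
    by (intro smooth_on_sum smooth_on_add open_S
        smooth_on_bounded_linear[OF open_S bounded_linear_scaleR_left] smooth_B)
  show "(\<Sum>\<mu>\<in>UNIV. \<Sum>\<nu>\<in>UNIV. B z (axis \<mu> 1) (axis \<nu> 1) *\<^sub>R ?M 1 \<mu> \<nu>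
      + B z (vert_J (axis \<mu> 1)) (axis \<nu> 1) *\<^sub>R ?M (- \<i>) \<mu> \<nu>) = H z" for z
  proof -
    have M: "?M x \<mu> \<nu> $ i $ j = (if \<mu> = i \<and> \<nu> = j then x else 0)" for x \<mu> \<nu> i j
      by (auto simp: axis_def)
    have T: "(B z (axis \<mu> 1) (axis \<nu> 1) *\<^sub>R ?M 1 \<mu> \<nu> + B z (vert_J (axis \<mu> 1)) (axis \<nu> 1) *\<^sub>R ?M (- \<i>) \<mu> \<nu>) $ i $ j
      = (if \<nu> = j then if \<mu> = i then hform z (axis \<mu> 1) (axis \<nu> 1) else 0 else 0)" for \<mu> \<nu> i j
      by (simp add: M hform_def complex_eq_iff)
    show ?thesis by (simp only: vec_eq_iff sum_component T) (simp add: H_def)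
  qed
qed

lemma ddir_hform:
  assumes z: "z \<in> S"
  shows "ddir x (\<lambda>z. hform z a b) z = Complex (dB z x a b) (- dB z x (vert_J a) b)"
proof -
  have *: "(\<lambda>z. hform z a b) = (\<lambda>z. complex_of_real (B z a b) + (- \<i>) * complex_of_real (B z (vert_J a) b))"
    by (rule ext) (simp add: hform_def complex_eq_iff)
  have "((\<lambda>z. complex_of_real (B z a b) + (- \<i>) * complex_of_real (B z (vert_J a) b)) has_derivative
     (\<lambda>x. complex_of_real (dB z x a b) + (- \<i>) * complex_of_real (dB z x (vert_J a) b))) (at z)"
    unfolding dB_def
    by (intro has_derivative_add has_derivative_mult_right has_derivative_of_real)
      (use B_diff[OF z] frechet_derivative_works in blast)+
  from ddir_eq[OF this, of x] show ?thesis unfolding * by (simp add: complex_eq_iff)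
qed

lemma H_entry: "H z $ \<mu> $ \<nu> = hform z (axis \<mu> 1) (axis \<nu> 1)"
  by (simp add: H_def)

lemma axis_i: "axis \<mu> \<i> = vert_J (axis \<mu> 1)"
  by (simp add: vert_J_def vec_eq_iff axis_def)

text \<open>The imaginary part is \<open>kaehler_real\<close>, and the real part is the same identity with the third vector
  rotated by \<open>J\<close>.\<close>

lemma wirtinger_H_sym:
  assumes z: "z \<in> S"
  shows "wirtinger (axis \<mu> 1) (axis \<mu> \<i>) (\<lambda>w. H w $ \<beta> $ \<tau>) z
       = wirtinger (axis \<beta> 1) (axis \<beta> \<i>) (\<lambda>w. H w $ \<mu> $ \<tau>) z"
  using kaehler_real[OF z, of "axis \<mu> 1" "axis \<beta> 1" "axis \<tau> 1"]
    kaehler_real[OF z, of "axis \<mu> 1" "axis \<beta> 1" "vert_J (axis \<tau> 1)"]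
    linear_neg[OF linear_dB2[OF z]]
  unfolding wirtinger_def axis_i H_entry ddir_hform[OF z]
  by (simp add: complex_eq_iff dB_J[OF z])

text \<open>The fundamental form is twice the real 2-form \<open>B(Ju, w)\<close>, to which \<open>kaehler_real\<close> applies.\<close>

lemma fund_form_H:
  assumes z: "z \<in> S"
  shows "fund_form H u w z = complex_of_real (2 * B z (vert_J u) w)"
proof -
  have "fund_form H u w z = \<i> * (hform z u w - hform z w u)"
    unfolding fund_form_def hform_H[OF z]
    by (simp add: sum_subtractf[symmetric] algebra_simps)
  also have "\<dots> = complex_of_real (2 * B z (vert_J u) w)"
    unfolding hform_cnj[OF z, of w u] by (simp add: hform_def complex_eq_iff)
  finally show ?thesis .
qed

lemma kaehler: "kaehler_on S H"
  unfolding kaehler_on_def hermitian_metric_on_def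
proof (intro conjI ballI allI impI)
  show "smooth_on S H" by (rule smooth_H)
  fix z assume z: "z \<in> S"
  show "H z $ \<nu> $ \<mu> = cnj (H z $ \<mu> $ \<nu>)" for \<mu> \<nu>
    unfolding H_entry by (rule hform_cnj[OF z])
  show "0 < Re (\<Sum>\<mu>\<in>UNIV. \<Sum>\<nu>\<in>UNIV. H z $ \<mu> $ \<nu> * v $ \<mu> * cnj (v $ \<nu>))" if "v \<noteq> 0" for v
    unfolding hform_H[OF z, symmetric] using B_pos[OF z that] by (simp add: hform_def)
  fix u1 u2 u3 :: "complex^'n"
  have d: "ddir x (fund_form H u w) z = complex_of_real (2 * dB z x (vert_J u) w)" for x u w
  proof -
    have "ddir x (fund_form H u w) z = ddir x (\<lambda>z. complex_of_real (2 * B z (vert_J u) w)) z"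
      by (rule ddir_cong[OF open_S z]) (rule fund_form_H)
    also have "\<dots> = complex_of_real (2 * dB z x (vert_J u) w)"
      unfolding dB_def
      by (rule ddir_bounded_linear[OF bounded_linear_compose[OF bounded_linear_of_real bounded_linear_mult_right, unfolded comp_def] B_diff[OF z]])
    finally show ?thesis .
  qed
  have skew: "dB z x (vert_J u) w = - dB z x (vert_J w) u" for x u w
    using dB_J[OF z, of x u w] dB_sym[OF z, of x "vert_J w" u] by linarith
  \<comment> \<open>In the cyclic sum of \<open>kaehler_real\<close> the terms that differentiate along a rotated vector cancel, and twice the exterior derivative remains.\<close>
  have "dB z u1 (vert_J u2) u3 - dB z u2 (vert_J u1) u3 + dB z u3 (vert_J u1) u2 = 0"
    using kaehler_real[OF z, of u1 u2 u3] kaehler_real[OF z, of u2 u3 u1] kaehler_real[OF z, of u3 u1 u2]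
      skew[of u1 u2 u3] skew[of u2 u1 u3] skew[of u3 u1 u2]
      dB_sym[OF z, of "vert_J u1" u2 u3] dB_sym[OF z, of "vert_J u2" u1 u3] dB_sym[OF z, of "vert_J u3" u1 u2]
    by linarith
  then show "ddir u1 (fund_form H u2 u3) z - ddir u2 (fund_form H u1 u3) z + ddir u3 (fund_form H u1 u2) z = 0"
    unfolding d by (simp flip: of_real_diff of_real_add distrib_left right_diff_distrib)
qed

end

section \<open>Polarisation of biquadratic forms\<close>

text \<open>Adding the values at \<open>l\<close> and \<open>- l\<close> removes the terms of odd degree; the three remaining coefficients
  are then determined by \<open>l = 1\<close>, \<open>\<i>\<close> and \<open>1 + \<i>\<close>.\<close>

lemma quadratic_coeff_zero:
  fixes c10 :: complex
  assumes "\<And>l. c10 * l + c01 * cnj l + c20 * l\<^sup>2 + c11 * (l * cnj l) + c02 * (cnj l)\<^sup>2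
      + c21 * (l\<^sup>2 * cnj l) + c12 * (l * (cnj l)\<^sup>2) = 0"
  shows "c20 = 0"
proof -
  have e: "c20 * l\<^sup>2 + c11 * (l * cnj l) + c02 * (cnj l)\<^sup>2 = 0" for l
  proof -
    have "2 * (c20 * l\<^sup>2 + c11 * (l * cnj l) + c02 * (cnj l)\<^sup>2) = 0"
      using arg_cong2[OF assms[of l] assms[of "- l"], of "(+)"] by (simp add: algebra_simps)
    then show ?thesis by (elim mult_eq_0_iff[THEN iffD1, THEN disjE]) simp_all
  qed
  have "Re c20 = 0 \<and> Im c20 = 0"
    using e[of 1] e[of \<i>] e[of "1 + \<i>"] unfolding complex_eq_iff
    by (simp add: power2_eq_square)
  then show ?thesis by (simp add: complex_eq_iff)
qed

text \<open>Holomorphic and antiholomorphic indices alternate in a curvature tensor, so that each of its symmetries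
  exchanges two indices at distance two.\<close>

lemma sum_swap3: "(\<Sum>a\<in>A. \<Sum>b\<in>B. \<Sum>c\<in>C. g a b c) = (\<Sum>c\<in>C. \<Sum>b\<in>B. \<Sum>a\<in>A. g a b c)"
proof -
  have "(\<Sum>a\<in>A. \<Sum>b\<in>B. \<Sum>c\<in>C. g a b c) = (\<Sum>b\<in>B. \<Sum>c\<in>C. \<Sum>a\<in>A. g a b c)"
    by (subst sum.swap, intro sum.cong refl sum.swap)
  also have "\<dots> = (\<Sum>c\<in>C. \<Sum>b\<in>B. \<Sum>a\<in>A. g a b c)" by (rule sum.swap)
  finally show ?thesis .
qed

text \<open>Matches the order of summation in the definition of constant holomorphic sectional curvature with that
  of a biquadratic form with lowered indices.\<close>

lemma sum_reorder5: "(\<Sum>b\<in>B. \<Sum>s\<in>C. \<Sum>m\<in>D. \<Sum>n\<in>E. \<Sum>a\<in>A. f b s m n a)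
    = (\<Sum>a\<in>A. \<Sum>m\<in>D. \<Sum>n\<in>E. \<Sum>s\<in>C. \<Sum>b\<in>B. f b s m n a)"
proof -
  have "(\<Sum>b\<in>B. \<Sum>s\<in>C. \<Sum>m\<in>D. \<Sum>n\<in>E. \<Sum>a\<in>A. f b s m n a)
      = (\<Sum>b\<in>B. \<Sum>s\<in>C. \<Sum>a\<in>A. \<Sum>m\<in>D. \<Sum>n\<in>E. f b s m n a)"
    by (intro sum.cong refl, subst sum_swap3, intro sum.cong refl sum.swap)
  also have "\<dots> = (\<Sum>a\<in>A. \<Sum>s\<in>C. \<Sum>b\<in>B. \<Sum>m\<in>D. \<Sum>n\<in>E. f b s m n a)" by (rule sum_swap3)
  also have "\<dots> = (\<Sum>a\<in>A. \<Sum>m\<in>D. \<Sum>b\<in>B. \<Sum>s\<in>C. \<Sum>n\<in>E. f b s m n a)"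
    by (intro sum.cong refl sum_swap3)
  also have "\<dots> = (\<Sum>a\<in>A. \<Sum>m\<in>D. \<Sum>n\<in>E. \<Sum>s\<in>C. \<Sum>b\<in>B. f b s m n a)"
    by (intro sum.cong refl sum_swap3)
  finally show ?thesis .
qed

text \<open>A form of bidegree \<open>(2, 2)\<close> that has the symmetries of a Kaehler curvature tensor is determined by its
  values on the diagonal.  On the complex line \<open>x + l y\<close> the coefficient of \<open>l\<^sup>2\<close> is
  \<open>P y x y x\<close>; after that, real polarisation in each symmetric pair of arguments suffices.\<close>

lemma biquadratic_form_zero:
  fixes Q :: "'n::finite \<Rightarrow> 'n \<Rightarrow> 'n \<Rightarrow> 'n \<Rightarrow> complex"
  assumes sym1: "\<And>b s m n. Q b s m n = Q m s b n"
    and sym2: "\<And>b s m n. Q b s m n = Q b n m s"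
    and zero: "\<And>v::complex^'n. (\<Sum>b\<in>UNIV. \<Sum>s\<in>UNIV. \<Sum>m\<in>UNIV. \<Sum>n\<in>UNIV.
      Q b s m n * v $ b * cnj (v $ s) * v $ m * cnj (v $ n)) = 0"
  shows "Q b s m n = 0"
proof -
  define P :: "complex^'n \<Rightarrow> complex^'n \<Rightarrow> complex^'n \<Rightarrow> complex^'n \<Rightarrow> complex" where
    "P x y u w = (\<Sum>b\<in>UNIV. \<Sum>s\<in>UNIV. \<Sum>m\<in>UNIV. \<Sum>n\<in>UNIV.
      Q b s m n * x $ b * cnj (y $ s) * u $ m * cnj (w $ n))" for x y u w
  have P_add: "P (x + x') y u w = P x y u w + P x' y u w" "P x (y + y') u w = P x y u w + P x y' u w"
    "P x y (u + u') w = P x y u w + P x y u' w" "P x y u (w + w') = P x y u w + P x y u w'"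
    for x x' y y' u u' w w'
    by (simp_all add: P_def sum.distrib[symmetric] algebra_simps)
  have P_scale: "P (l *s x) y u w = l * P x y u w" "P x (l *s y) u w = cnj l * P x y u w"
    "P x y (l *s u) w = l * P x y u w" "P x y u (l *s w) = cnj l * P x y u w" for l x y u w
    by (simp_all add: P_def sum_distrib_left mult_ac)
  have P_sym1: "P x y u w = P u y x w" for x y u w
    unfolding P_def
    by (subst sum_swap3, intro sum.cong refl, subst sym1) (simp add: mult_ac)
  have P_sym2: "P x y u w = P x w u y" for x y u w
    unfolding P_def
    by (rule sum.cong[OF refl], subst sum_swap3, intro sum.cong refl, subst sym2) (simp add: mult_ac)
  have P_zero: "P v v v v = 0" for v unfolding P_def by (rule zero)
  have 1: "P y x y x = 0" for x y
  proof (rule quadratic_coeff_zero)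
    fix l
    have "P (x + l *s y) (x + l *s y) (x + l *s y) (x + l *s y) = 0" by (rule P_zero)
    then show "(2 * P y x x x) * l + (2 * P x y x x) * cnj l + P y x y x * l\<^sup>2 + (4 * P y y x x) * (l * cnj l)
      + P x y x y * (cnj l)\<^sup>2 + (2 * P y y y x) * (l\<^sup>2 * cnj l) + (2 * P y y x y) * (l * (cnj l)\<^sup>2) = 0"
      unfolding P_add P_scale
      using P_zero P_sym1[of x x y x] P_sym2[of x x x y] P_sym1[of x y y x] P_sym2[of y x x y] P_sym1[of x x y y] P_sym2[of x x y y]
        P_sym2[of y x y y] P_sym1[of x y y y]
      by (simp add: power2_eq_square algebra_simps)
  qed
  have 2: "P a x b x = 0" for a b x
    using 1[of "a + b" x] 1[of a x] 1[of b x] P_sym1[of a x b x] by (simp add: P_add)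
  have 3: "P a c b d = 0" for a b c d
    using 2[of a "c + d" b] 2[of a c b] 2[of a d b] P_sym2[of a c b d] by (simp add: P_add)
  have "P (axis b 1) (axis s 1) (axis m 1) (axis n 1) = Q b s m n"
    unfolding P_def axis_def
    by (simp add: if_distrib[of cnj] if_distrib[of "\<lambda>x. _ * x"] if_distribR cong: if_cong)
  then show ?thesis using 3 by simp
qed

section \<open>Wirtinger derivatives and matrix inverses\<close>

lemma ddir_mult:
  fixes f g :: "'a::real_normed_vector \<Rightarrow> complex"
  assumes "f differentiable (at p)" "g differentiable (at p)"
  shows "ddir u (\<lambda>x. f x * g x) p = f p * ddir u g p + ddir u f p * g p"
  by (rule ddir_bilinear[OF bounded_bilinear_mult assms])

lemma wirtinger_cong:
  assumes "open S" "p \<in> S" "\<And>q. q \<in> S \<Longrightarrow> f q = g q"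
  shows "wirtinger u u' f p = wirtinger u u' g p" "wirtinger_bar u u' f p = wirtinger_bar u u' g p"
  using ddir_cong[OF assms] by (simp_all add: wirtinger_def wirtinger_bar_def)

lemma wirtinger_bar_sum:
  assumes "\<And>i. i \<in> I \<Longrightarrow> f i differentiable (at p)"
  shows "wirtinger_bar u u' (\<lambda>x. \<Sum>i\<in>I. f i x) p = (\<Sum>i\<in>I. wirtinger_bar u u' (f i) p)"
  using ddir_sum[of I f p, OF assms]
  by (simp add: wirtinger_bar_def sum.distrib sum_distrib_left flip: sum_divide_distrib)

lemma wirtinger_bar_mult:
  assumes "f differentiable (at p)" "g differentiable (at p)"
  shows "wirtinger_bar u u' (\<lambda>x. f x * g x) p = f p * wirtinger_bar u u' g p + wirtinger_bar u u' f p * g p"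
  by (simp add: wirtinger_bar_def ddir_mult[OF assms] field_simps)

lemma wirtinger_bar_cnj:
  assumes "f differentiable (at p)"
  shows "wirtinger_bar u u' (\<lambda>x. cnj (f x)) p = cnj (wirtinger u u' f p)"
  using ddir_bounded_linear[OF bounded_linear_cnj assms] by (simp add: wirtinger_def wirtinger_bar_def)

lemma smooth_on_differentiable_ddir: "smooth_on S f \<Longrightarrow> p \<in> S \<Longrightarrow> ddir u f differentiable (at p)"
  by (rule smooth_on_differentiable[OF smooth_on_ddir])

lemma differentiable_wirtinger:
  assumes "smooth_on S f" "p \<in> S"
  shows "wirtinger u u' f differentiable (at p)" "wirtinger_bar u u' f differentiable (at p)"
proof -
  note d = smooth_on_differentiable_ddir[OF assms]
  have "(\<lambda>p. 1/2 * (ddir u f p - \<i> * ddir u' f p)) differentiable (at p)"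
    "(\<lambda>p. 1/2 * (ddir u f p + \<i> * ddir u' f p)) differentiable (at p)"
    by (intro differentiable_mult differentiable_diff differentiable_add differentiable_const d)+
  then show "wirtinger u u' f differentiable (at p)" "wirtinger_bar u u' f differentiable (at p)"
    by (simp_all add: wirtinger_def[abs_def] wirtinger_bar_def[abs_def])
qed

lemma wirtinger_commute:
  assumes S: "open S" "p \<in> S" and f: "smooth_on S f"
  shows "wirtinger_bar u u' (wirtinger a a' f) p = wirtinger a a' (wirtinger_bar u u' f) p"
proof -
  note d = smooth_on_differentiable_ddir[OF f S(2)]
  have 1: "ddir x (\<lambda>p. (ddir y f p - \<i> * ddir y' f p) / 2) p = (ddir x (ddir y f) p - \<i> * ddir x (ddir y' f) p) / 2"
    and 2: "ddir x (\<lambda>p. (ddir y f p + \<i> * ddir y' f p) / 2) p = (ddir x (ddir y f) p + \<i> * ddir x (ddir y' f) p) / 2"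
    for x y y'
    by (rule ddir_eq, intro bounded_linear.has_derivative[OF bounded_linear_divide] has_derivative_diff
       has_derivative_add has_derivative_mult_right d[unfolded frechet_derivative_works])+
  show ?thesis
    unfolding wirtinger_def[abs_def] wirtinger_bar_def[abs_def] 1 2
    by (simp add: ddir_commute[OF S f, of a] ddir_commute[OF S f, of a'] field_simps)
qed

lemma differentiable_det:
  fixes A :: "'a::real_normed_vector \<Rightarrow> complex^'n^'n"
  assumes "\<And>i j. (\<lambda>x. A x $ i $ j) differentiable (at p)"
  shows "(\<lambda>x. det (A x)) differentiable (at p)"
proof -
  have prod: "(\<lambda>x. \<Prod>i\<in>I. f i x) differentiable (at p)"
    if "\<And>i. f i differentiable (at p)" for f :: "'n \<Rightarrow> 'a \<Rightarrow> complex" and I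
    using that by (induction I rule: infinite_finite_induct) (auto intro!: differentiable_mult)
  show ?thesis unfolding det_def
    by (intro differentiable_sum differentiable_mult differentiable_const) (auto intro!: prod assms)
qed

lemma invertible_matrix_inv:
  assumes "invertible A"
  shows "A ** matrix_inv A = mat 1" "matrix_inv A ** A = mat 1"
  using someI_ex[OF assms[unfolded invertible_def]] unfolding matrix_inv_def by auto

text \<open>By Cramer's rule the entries of the inverse are quotients of determinants, which are polynomials in
  the entries.\<close>

lemma differentiable_matrix_inv:
  fixes A :: "'a::real_normed_vector \<Rightarrow> complex^'n^'n"
  assumes S: "open S" "p \<in> S" and inv: "\<And>x. x \<in> S \<Longrightarrow> invertible (A x)"
    and A: "\<And>i j. (\<lambda>x. A x $ i $ j) differentiable (at p)"
  shows "(\<lambda>x. matrix_inv (A x) $ k $ l) differentiable (at p)"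
proof -
  let ?C = "\<lambda>x. \<chi> i j. if j = k then axis l 1 $ i else A x $ i $ j"
  have eq: "matrix_inv (A x) $ k $ l = det (?C x) / det (A x)" if "x \<in> S" for x
  proof -
    have "A x *v (matrix_inv (A x) *v axis l 1) = axis l 1"
      by (simp add: matrix_vector_mul_assoc invertible_matrix_inv[OF inv[OF that]])
    then have "matrix_inv (A x) *v axis l 1 = (\<chi> k. det (\<chi> i j. if j = k then axis l 1 $ i else A x $ i $ j) / det (A x))"
      using cramer[of "A x"] inv[OF that] by (simp add: invertible_det_nz)
    then have "(matrix_inv (A x) *v axis l 1) $ k = det (?C x) / det (A x)" by simp
    moreover have "(matrix_inv (A x) *v axis l 1) $ k = (\<Sum>j\<in>UNIV. if j = l then matrix_inv (A x) $ k $ j else 0)"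
      unfolding matrix_vector_mult_def vec_lambda_beta by (rule sum.cong) (auto simp: axis_def)
    ultimately show ?thesis by simp
  qed
  have "(\<lambda>x. det (?C x) / det (A x)) differentiable (at p)"
  proof (intro differentiable_divide differentiable_det A)
    show "(\<lambda>x. ?C x $ i $ j) differentiable (at p)" for i j
      using A by (cases "j = k") auto
    show "det (A p) \<noteq> 0" using inv[OF S(2)] by (simp add: invertible_det_nz)
  qed
  then show ?thesis using differentiable_cong_open[OF S eq] by simp
qed

text \<open>All functions on the tangent bundle that occur in the curvature of a Hermitian metric are complex
  linear in the fibre variable.  For these, base derivatives act on the coefficients, the holomorphic
  fibre derivative picks a coefficient, and the antiholomorphic one vanishes.\<close>

lemma fibre_linear:
  fixes c :: "'n::finite \<Rightarrow> complex^'n \<Rightarrow> complex"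
  assumes \<Omega>: "open \<Omega>" "(z, v) \<in> \<Omega>" and f: "\<And>z v. (z, v) \<in> \<Omega> \<Longrightarrow> f (z, v) = (\<Sum>\<beta>\<in>UNIV. c \<beta> z * v $ \<beta>)"
    and c: "\<And>\<beta>. c \<beta> differentiable (at z)"
  shows "dz \<mu> f (z, v) = (\<Sum>\<beta>\<in>UNIV. wirtinger (axis \<mu> 1) (axis \<mu> \<i>) (c \<beta>) z * v $ \<beta>)"
    and "dz_bar \<mu> f (z, v) = (\<Sum>\<beta>\<in>UNIV. wirtinger_bar (axis \<mu> 1) (axis \<mu> \<i>) (c \<beta>) z * v $ \<beta>)"
    and "dv \<mu> f (z, v) = c \<mu> z"
    and "dv_bar \<mu> f (z, v) = 0"
proof -
  have cz: "((\<lambda>q. c \<beta> (fst q)) has_derivative (\<lambda>u. ddir (fst u) (c \<beta>) z)) (at (z, v))" for \<beta>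
    using diff_chain_at[OF has_derivative_fst[OF has_derivative_ident], of "c \<beta>" _ "(z, v)"] c[of \<beta>, unfolded frechet_derivative_works]
    by (simp add: comp_def has_derivative_fst)
  have "((\<lambda>q. \<Sum>\<beta>\<in>UNIV. c \<beta> (fst q) * snd q $ \<beta>) has_derivative
      (\<lambda>u. \<Sum>\<beta>\<in>UNIV. c \<beta> z * snd u $ \<beta> + ddir (fst u) (c \<beta>) z * v $ \<beta>)) (at (z, v))"
    by (rule has_derivative_sum, rule has_derivative_eq_rhs, rule has_derivative_mult[OF cz])
      (auto intro!: bounded_linear.has_derivative[OF bounded_linear_vec_nth] has_derivative_snd has_derivative_ident)
  from ddir_eq[OF this]
  have d: "ddir u f (z, v) = (\<Sum>\<beta>\<in>UNIV. c \<beta> z * snd u $ \<beta> + ddir (fst u) (c \<beta>) z * v $ \<beta>)" for u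
    using ddir_cong[OF \<Omega>, of f "\<lambda>q. \<Sum>\<beta>\<in>UNIV. c \<beta> (fst q) * snd q $ \<beta>" u] f by auto
  have 0: "ddir 0 (c \<beta>) z = 0" for \<beta>
    using linear_0[OF ddir_linear[OF c]] .
  have ax: "(\<Sum>\<beta>\<in>UNIV. c \<beta> z * axis \<mu> x $ \<beta>) = c \<mu> z * x" for x
  proof -
    have "c \<beta> z * axis \<mu> x $ \<beta> = (if \<beta> = \<mu> then c \<beta> z * x else 0)" for \<beta> by (simp add: axis_def)
    then show ?thesis by simp
  qed
  show "dz \<mu> f (z, v) = (\<Sum>\<beta>\<in>UNIV. wirtinger (axis \<mu> 1) (axis \<mu> \<i>) (c \<beta>) z * v $ \<beta>)"
    by (simp add: dz_def wirtinger_def d sum_subtractf sum_distrib_left sum_divide_distrib algebra_simps diff_divide_distrib)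
  show "dz_bar \<mu> f (z, v) = (\<Sum>\<beta>\<in>UNIV. wirtinger_bar (axis \<mu> 1) (axis \<mu> \<i>) (c \<beta>) z * v $ \<beta>)"
    by (simp add: dz_bar_def wirtinger_bar_def d sum.distrib sum_distrib_left sum_divide_distrib algebra_simps add_divide_distrib)
  show "dv \<mu> f (z, v) = c \<mu> z" "dv_bar \<mu> f (z, v) = 0"
    by (simp_all add: dv_def dv_bar_def wirtinger_def wirtinger_bar_def d 0 ax mult.commute[of _ \<i>])
qed

section \<open>Curvature of the Hermitian metric\<close>

context finsler_chart
begin

abbreviation dw :: "'n \<Rightarrow> (complex^'n \<Rightarrow> complex) \<Rightarrow> complex^'n \<Rightarrow> complex" where
  "dw \<mu> \<equiv> wirtinger (axis \<mu> 1) (axis \<mu> \<i>)"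

abbreviation dw_bar :: "'n \<Rightarrow> (complex^'n \<Rightarrow> complex) \<Rightarrow> complex^'n \<Rightarrow> complex" where
  "dw_bar \<mu> \<equiv> wirtinger_bar (axis \<mu> 1) (axis \<mu> \<i>)"

lemma smooth_H_entry: "smooth_on S (\<lambda>z. H z $ \<mu> $ \<nu>)"
  by (intro smooth_on_bounded_linear[OF open_S bounded_linear_vec_nth, of "\<lambda>z. H z $ \<mu>"]
     smooth_on_bounded_linear[OF open_S bounded_linear_vec_nth, of H] smooth_H)

lemma H_cnj: "z \<in> S \<Longrightarrow> H z $ \<nu> $ \<mu> = cnj (H z $ \<mu> $ \<nu>)"
  unfolding H_entry by (rule hform_cnj)

text \<open>If \<open>H x = 0\<close>, then \<open>H\<close> vanishes on the diagonal at the conjugate of \<open>x\<close>: the contraction is with the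
  second, conjugate linear index.\<close>

lemma invertible_H:
  assumes z: "z \<in> S"
  shows "invertible (H z)"
proof -
  have "x = 0" if "H z *v x = 0" for x
  proof (rule ccontr)
    assume "x \<noteq> 0"
    have "hform z (\<chi> i. cnj (x $ i)) (\<chi> i. cnj (x $ i)) = (\<Sum>\<mu>\<in>UNIV. cnj (x $ \<mu>) * (H z *v x) $ \<mu>)"
      unfolding hform_H[OF z] matrix_vector_mult_def by (simp add: sum_distrib_left mult_ac)
    then have "hform z (\<chi> i. cnj (x $ i)) (\<chi> i. cnj (x $ i)) = 0" using that by simp
    then have "B z (\<chi> i. cnj (x $ i)) (\<chi> i. cnj (x $ i)) = 0"
      by (simp add: hform_def complex_eq_iff)
    moreover have "(\<chi> i. cnj (x $ i)) \<noteq> 0" using \<open>x \<noteq> 0\<close> by (simp add: vec_eq_iff)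
    ultimately show False using B_pos[OF z] by force
  qed
  then show ?thesis using matrix_left_invertible_ker invertible_left_inverse by blast
qed

lemma H_inv:
  assumes z: "z \<in> S"
  shows "(\<Sum>\<tau>\<in>UNIV. H z $ \<beta> $ \<tau> * matrix_inv (H z) $ \<tau> $ \<alpha>) = (if \<beta> = \<alpha> then 1 else 0)"
    and "(\<Sum>\<alpha>\<in>UNIV. matrix_inv (H z) $ \<tau> $ \<alpha> * H z $ \<alpha> $ \<sigma>) = (if \<tau> = \<sigma> then 1 else 0)"
proof -
  have "(H z ** matrix_inv (H z)) $ \<beta> $ \<alpha> = (mat 1 :: complex^'n^'n) $ \<beta> $ \<alpha>"
    "(matrix_inv (H z) ** H z) $ \<tau> $ \<sigma> = (mat 1 :: complex^'n^'n) $ \<tau> $ \<sigma>"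
    by (simp_all add: invertible_matrix_inv[OF invertible_H[OF z]])
  then show "(\<Sum>\<tau>\<in>UNIV. H z $ \<beta> $ \<tau> * matrix_inv (H z) $ \<tau> $ \<alpha>) = (if \<beta> = \<alpha> then 1 else 0)"
    and "(\<Sum>\<alpha>\<in>UNIV. matrix_inv (H z) $ \<tau> $ \<alpha> * H z $ \<alpha> $ \<sigma>) = (if \<tau> = \<sigma> then 1 else 0)"
    by (simp_all add: matrix_matrix_mult_def mat_def)
qed

lemma dw_bar_H_sym:
  assumes z: "z \<in> S"
  shows "dw_bar \<nu> (\<lambda>w. H w $ \<alpha> $ \<sigma>) z = dw_bar \<sigma> (\<lambda>w. H w $ \<alpha> $ \<nu>) z"
proof -
  have "dw_bar \<nu> (\<lambda>w. H w $ \<alpha> $ \<sigma>) z = cnj (dw \<nu> (\<lambda>w. H w $ \<sigma> $ \<alpha>) z)" for \<nu> \<sigma>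
  proof -
    have "dw_bar \<nu> (\<lambda>w. H w $ \<alpha> $ \<sigma>) z = dw_bar \<nu> (\<lambda>w. cnj (H w $ \<sigma> $ \<alpha>)) z"
      by (rule wirtinger_cong(2)[OF open_S z]) (rule H_cnj)
    then show ?thesis
      by (simp add: wirtinger_bar_cnj smooth_on_differentiable[OF smooth_H_entry z])
  qed
  then show ?thesis using wirtinger_H_sym[OF z] by simp
qed

lemma differentiable_christoffel:
  assumes z: "z \<in> S"
  shows "christoffel H \<alpha> \<beta> \<mu> differentiable (at z)"
proof -
  have "(\<lambda>x. matrix_inv (H x) $ \<tau> $ \<alpha>) differentiable (at z)" for \<tau>
    by (rule differentiable_matrix_inv[OF open_S z invertible_H smooth_on_differentiable[OF smooth_H_entry z]])
  then show ?thesis unfolding christoffel_def[abs_def]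
    using differentiable_wirtinger(1)[OF smooth_H_entry z]
    by (intro differentiable_sum ballI differentiable_mult) simp_all
qed

text \<open>Christoffel symbols with lowered index are free of the inverse matrix, so that differentiating this
  identity computes the lowered curvature.\<close>

lemma lower_christoffel:
  assumes z: "z \<in> S"
  shows "(\<Sum>\<alpha>\<in>UNIV. H z $ \<alpha> $ \<sigma> * christoffel H \<alpha> \<beta> \<mu> z) = dw \<mu> (\<lambda>w. H w $ \<beta> $ \<sigma>) z"
proof -
  have "(\<Sum>\<alpha>\<in>UNIV. H z $ \<alpha> $ \<sigma> * christoffel H \<alpha> \<beta> \<mu> z)
    = (\<Sum>\<alpha>\<in>UNIV. \<Sum>\<tau>\<in>UNIV. dw \<mu> (\<lambda>w. H w $ \<beta> $ \<tau>) z * (matrix_inv (H z) $ \<tau> $ \<alpha> * H z $ \<alpha> $ \<sigma>))"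
    by (simp add: christoffel_def sum_distrib_left mult_ac)
  also have "\<dots> = (\<Sum>\<tau>\<in>UNIV. dw \<mu> (\<lambda>w. H w $ \<beta> $ \<tau>) z * (\<Sum>\<alpha>\<in>UNIV. matrix_inv (H z) $ \<tau> $ \<alpha> * H z $ \<alpha> $ \<sigma>))"
    unfolding sum_distrib_left by (rule sum.swap)
  also have "\<dots> = dw \<mu> (\<lambda>w. H w $ \<beta> $ \<sigma>) z"
    by (simp add: H_inv(2)[OF z] if_distrib cong: if_cong)
  finally show ?thesis .
qed

text \<open>The curvature tensor with its upper index lowered to the conjugate index \<open>\<sigma>\<close>.\<close>

definition R_low :: "'n \<Rightarrow> 'n \<Rightarrow> 'n \<Rightarrow> 'n \<Rightarrow> complex^'n \<Rightarrow> complex" where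
  "R_low \<beta> \<sigma> \<mu> \<nu> z = (\<Sum>\<alpha>\<in>UNIV. H z $ \<alpha> $ \<sigma> * curv_tensor H \<alpha> \<beta> \<mu> \<nu> z)"

lemma R_low_eq:
  assumes z: "z \<in> S"
  shows "R_low \<beta> \<sigma> \<mu> \<nu> z = (\<Sum>\<alpha>\<in>UNIV. dw_bar \<nu> (\<lambda>w. H w $ \<alpha> $ \<sigma>) z * christoffel H \<alpha> \<beta> \<mu> z)
     - dw_bar \<nu> (dw \<mu> (\<lambda>w. H w $ \<beta> $ \<sigma>)) z"
proof -
  note d = smooth_on_differentiable[OF smooth_H_entry z] differentiable_christoffel[OF z]
  have "dw_bar \<nu> (dw \<mu> (\<lambda>w. H w $ \<beta> $ \<sigma>)) z
      = dw_bar \<nu> (\<lambda>w. \<Sum>\<alpha>\<in>UNIV. H w $ \<alpha> $ \<sigma> * christoffel H \<alpha> \<beta> \<mu> w) z"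
    by (rule wirtinger_cong(2)[OF open_S z]) (simp add: lower_christoffel)
  also have "\<dots> = (\<Sum>\<alpha>\<in>UNIV. dw_bar \<nu> (\<lambda>w. H w $ \<alpha> $ \<sigma> * christoffel H \<alpha> \<beta> \<mu> w) z)"
    by (intro wirtinger_bar_sum differentiable_mult d)
  also have "\<dots> = (\<Sum>\<alpha>\<in>UNIV. dw_bar \<nu> (\<lambda>w. H w $ \<alpha> $ \<sigma>) z * christoffel H \<alpha> \<beta> \<mu> z) - R_low \<beta> \<sigma> \<mu> \<nu> z"
    by (simp add: wirtinger_bar_mult[OF d] R_low_def curv_tensor_def sum.distrib sum_negf)
  finally show ?thesis by simp
qed

text \<open>Symmetry in the holomorphic indices is that of the Christoffel symbols.  Symmetry in the
  antiholomorphic ones is seen in \<open>R_low_eq\<close>: there each derivative along \<open>\<nu>\<close> falls on an entry of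
  \<open>H\<close> with conjugate index \<open>\<sigma>\<close>, so the conjugate Kaehler symmetry exchanges the two.\<close>

lemma R_low_sym1:
  assumes z: "z \<in> S"
  shows "R_low \<beta> \<sigma> \<mu> \<nu> z = R_low \<mu> \<sigma> \<beta> \<nu> z"
proof -
  have "christoffel H \<alpha> \<beta> \<mu> w = christoffel H \<alpha> \<mu> \<beta> w" if "w \<in> S" for w \<alpha>
    unfolding christoffel_def using wirtinger_H_sym[OF that, of \<mu> \<beta>] by simp
  then have "curv_tensor H \<alpha> \<beta> \<mu> \<nu> z = curv_tensor H \<alpha> \<mu> \<beta> \<nu> z" for \<alpha>
    unfolding curv_tensor_def using wirtinger_cong(2)[OF open_S z] by metis
  then show ?thesis by (simp add: R_low_def)
qed

lemma R_low_sym2: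
  assumes z: "z \<in> S"
  shows "R_low \<beta> \<sigma> \<mu> \<nu> z = R_low \<beta> \<nu> \<mu> \<sigma> z"
proof -
  have "dw_bar \<nu> (dw \<mu> (\<lambda>w. H w $ \<beta> $ \<sigma>)) z = dw \<mu> (dw_bar \<nu> (\<lambda>w. H w $ \<beta> $ \<sigma>)) z" for \<nu> \<sigma>
    by (rule wirtinger_commute[OF open_S z smooth_H_entry])
  moreover have "dw \<mu> (dw_bar \<nu> (\<lambda>w. H w $ \<beta> $ \<sigma>)) z = dw \<mu> (dw_bar \<sigma> (\<lambda>w. H w $ \<beta> $ \<nu>)) z"
    by (rule wirtinger_cong(1)[OF open_S z]) (rule dw_bar_H_sym)
  moreover have "dw_bar \<nu> (\<lambda>w. H w $ \<alpha> $ \<sigma>) z = dw_bar \<sigma> (\<lambda>w. H w $ \<alpha> $ \<nu>) z" for \<alpha>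
    by (rule dw_bar_H_sym[OF z])
  ultimately show ?thesis by (simp add: R_low_eq[OF z])
qed

abbreviation "Gc \<equiv> \<lambda>q. complex_of_real (G q)"

text \<open>Fibre derivatives of \<open>G\<close> come from the first Euler identity \<open>dG(u) = hess(u, v) = 2 B(u, v)\<close>.\<close>

lemma Gc_fibre_derivs:
  assumes p: "(z, v) \<in> \<Omega>"
  shows "dv \<alpha> Gc (z, v) = (\<Sum>\<sigma>\<in>UNIV. H z $ \<alpha> $ \<sigma> * cnj (v $ \<sigma>))"
    and "dv_bar \<alpha> Gc (z, v) = (\<Sum>\<beta>\<in>UNIV. H z $ \<beta> $ \<alpha> * v $ \<beta>)"
proof -
  have z: "z \<in> S" using p by (simp add: \<Omega>_def)
  have d: "ddir (0, u) Gc (z, v) = complex_of_real (2 * B z u v)" for u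
    using ddir_bounded_linear[OF bounded_linear_of_real smooth_on_differentiable[OF smooth p], of "(0, u)"]
      hess_radial[OF p, of u] hess_B[OF p, of u v] by simp
  have "dv \<alpha> Gc (z, v) = hform z (axis \<alpha> 1) v"
    by (simp add: dv_def wirtinger_def d axis_i hform_def complex_eq_iff)
  also have "\<dots> = (\<Sum>\<mu>\<in>UNIV. if \<mu> = \<alpha> then (\<Sum>\<sigma>\<in>UNIV. H z $ \<mu> $ \<sigma> * cnj (v $ \<sigma>)) else 0)"
    unfolding hform_H[OF z] by (rule sum.cong) (auto simp: axis_def)
  finally show "dv \<alpha> Gc (z, v) = (\<Sum>\<sigma>\<in>UNIV. H z $ \<alpha> $ \<sigma> * cnj (v $ \<sigma>))" by simp
  have "dv_bar \<alpha> Gc (z, v) = cnj (hform z (axis \<alpha> 1) v)"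
    by (simp add: dv_bar_def wirtinger_bar_def d axis_i hform_def complex_eq_iff)
  also have "\<dots> = hform z v (axis \<alpha> 1)" by (rule hform_cnj[OF z, symmetric])
  also have "\<dots> = (\<Sum>\<mu>\<in>UNIV. \<Sum>\<nu>\<in>UNIV. if \<nu> = \<alpha> then H z $ \<mu> $ \<nu> * v $ \<mu> else 0)"
    unfolding hform_H[OF z] by (intro sum.cong refl) (auto simp: axis_def)
  finally show "dv_bar \<alpha> Gc (z, v) = (\<Sum>\<beta>\<in>UNIV. H z $ \<beta> $ \<alpha> * v $ \<beta>)" by simp
qed

lemma levi_matrix_Gc: "(z, v) \<in> \<Omega> \<Longrightarrow> levi_matrix Gc (z, v) = H z"
  using fibre_linear(3)[OF open_\<Omega> _ Gc_fibre_derivs(2) smooth_on_differentiable[OF smooth_H_entry]]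
  by (simp add: levi_matrix_def vec_eq_iff \<Omega>_def)

lemma chern_finsler_Gc:
  assumes "(z, v) \<in> \<Omega>"
  shows "chern_finsler Gc \<alpha> \<mu> (z, v) = (\<Sum>\<beta>\<in>UNIV. christoffel H \<alpha> \<beta> \<mu> z * v $ \<beta>)"
proof -
  have z: "z \<in> S" using assms by (simp add: \<Omega>_def)
  have "chern_finsler Gc \<alpha> \<mu> (z, v) = (\<Sum>\<tau>\<in>UNIV. \<Sum>\<beta>\<in>UNIV. matrix_inv (H z) $ \<tau> $ \<alpha> * (dw \<mu> (\<lambda>w. H w $ \<beta> $ \<tau>) z * v $ \<beta>))"
    unfolding chern_finsler_def levi_matrix_Gc[OF assms]
    by (subst fibre_linear(1)[OF open_\<Omega> assms Gc_fibre_derivs(2) smooth_on_differentiable[OF smooth_H_entry z]])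
      (simp_all add: sum_distrib_left)
  also have "\<dots> = (\<Sum>\<beta>\<in>UNIV. \<Sum>\<tau>\<in>UNIV. matrix_inv (H z) $ \<tau> $ \<alpha> * (dw \<mu> (\<lambda>w. H w $ \<beta> $ \<tau>) z * v $ \<beta>))"
    by (rule sum.swap)
  finally show ?thesis by (simp add: christoffel_def sum_distrib_right mult.assoc)
qed

lemma delta_bar_chern_finsler:
  assumes p: "(z, v) \<in> \<Omega>"
  shows "delta_bar Gc \<nu> (chern_finsler Gc \<alpha> \<mu>) (z, v) = - (\<Sum>\<beta>\<in>UNIV. curv_tensor H \<alpha> \<beta> \<mu> \<nu> z * v $ \<beta>)"
proof -
  have z: "z \<in> S" using p by (simp add: \<Omega>_def)
  have 1: "dz_bar \<nu> (chern_finsler Gc \<alpha> \<mu>) (z, v) = (\<Sum>\<beta>\<in>UNIV. dw_bar \<nu> (christoffel H \<alpha> \<beta> \<mu>) z * v $ \<beta>)"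
    by (rule fibre_linear(2)[OF open_\<Omega> p chern_finsler_Gc differentiable_christoffel[OF z]])
  have 2: "dv_bar \<gamma> (chern_finsler Gc \<alpha> \<mu>) (z, v) = 0" for \<gamma>
    by (rule fibre_linear(4)[OF open_\<Omega> p chern_finsler_Gc differentiable_christoffel[OF z]])
  show ?thesis
    unfolding delta_bar_def 1 2 by (simp add: curv_tensor_def sum_negf)
qed

text \<open>The curvature of a complex space form.  The right hand side is the symmetrisation of
  \<open>H\<^sub>\<beta>\<^sub>\<sigma> H\<^sub>\<mu>\<^sub>\<nu>\<close>, and has the same diagonal values as \<open>R_low\<close> by the curvature assumption.\<close>

lemma R_low_const_curv:
  assumes curv: "\<And>p. p \<in> \<Omega> \<Longrightarrow> - 2 * (\<Sum>\<alpha>\<in>UNIV. \<Sum>\<mu>\<in>UNIV. \<Sum>\<nu>\<in>UNIV.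
      dv \<alpha> Gc p * delta_bar Gc \<nu> (chern_finsler Gc \<alpha> \<mu>) p * snd p $ \<mu> * cnj (snd p $ \<nu>))
        = complex_of_real c * (Gc p)\<^sup>2"
    and z: "z \<in> S"
  shows "R_low \<beta> \<sigma> \<mu> \<nu> z = complex_of_real c / 4 * (H z $ \<beta> $ \<sigma> * H z $ \<mu> $ \<nu> + H z $ \<beta> $ \<nu> * H z $ \<mu> $ \<sigma>)"
proof -
  define Q where "Q \<beta> \<sigma> \<mu> \<nu> = R_low \<beta> \<sigma> \<mu> \<nu> z - complex_of_real c / 4 * (H z $ \<beta> $ \<sigma> * H z $ \<mu> $ \<nu> + H z $ \<beta> $ \<nu> * H z $ \<mu> $ \<sigma>)" for \<beta> \<sigma> \<mu> \<nu>
  have "Q \<beta> \<sigma> \<mu> \<nu> = 0"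
  proof (rule biquadratic_form_zero)
    show "Q b s m n = Q m s b n" for b s m n
      using R_low_sym1[OF z, of b s m n] by (simp add: Q_def mult_ac add_ac)
    show "Q b s m n = Q b n m s" for b s m n
      using R_low_sym2[OF z, of b s m n] by (simp add: Q_def mult_ac add_ac)
    fix v :: "complex^'n"
    let ?S = "\<lambda>T. \<Sum>b\<in>UNIV. \<Sum>s\<in>UNIV. \<Sum>m\<in>UNIV. \<Sum>n\<in>UNIV. T b s m n * v $ b * cnj (v $ s) * v $ m * cnj (v $ n)"
    show "?S Q = 0"
    proof (cases "v = 0")
      case True
      then show ?thesis by simp
    next
      case False
      then have p: "(z, v) \<in> \<Omega>" using z by (simp add: \<Omega>_def)
      have HH: "?S (\<lambda>b s m n. H z $ b $ s * H z $ m $ n) = (Gc (z, v))\<^sup>2"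
      proof -
        let ?X = "\<Sum>b\<in>UNIV. \<Sum>s\<in>UNIV. H z $ b $ s * v $ b * cnj (v $ s)"
        have "?X * ?X = (\<Sum>b\<in>UNIV. \<Sum>s\<in>UNIV. H z $ b $ s * v $ b * cnj (v $ s) * ?X)"
          by (simp only: sum_distrib_right)
        also have "\<dots> = ?S (\<lambda>b s m n. H z $ b $ s * H z $ m $ n)"
          by (intro sum.cong refl) (simp add: sum_distrib_left mult_ac)
        finally show ?thesis unfolding G_hform[OF z] hform_H[OF z] power2_eq_square ..
      qed
      have HH': "?S (\<lambda>b s m n. H z $ b $ n * H z $ m $ s) = (Gc (z, v))\<^sup>2"
        unfolding HH[symmetric]
        by (rule sum.cong[OF refl], subst sum_swap3, intro sum.cong refl) (simp add: mult_ac)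
      have RR: "2 * ?S (\<lambda>b s m n. R_low b s m n z) = complex_of_real c * (Gc (z, v))\<^sup>2"
      proof -
        let ?T = "\<lambda>b s m n a. H z $ a $ s * curv_tensor H a b m n z * v $ b * cnj (v $ s) * v $ m * cnj (v $ n)"
        have "?S (\<lambda>b s m n. R_low b s m n z) = (\<Sum>b\<in>UNIV. \<Sum>s\<in>UNIV. \<Sum>m\<in>UNIV. \<Sum>n\<in>UNIV. \<Sum>a\<in>UNIV. ?T b s m n a)"
          unfolding R_low_def sum_distrib_right ..
        also have "\<dots> = (\<Sum>a\<in>UNIV. \<Sum>m\<in>UNIV. \<Sum>n\<in>UNIV. \<Sum>s\<in>UNIV. \<Sum>b\<in>UNIV. ?T b s m n a)"
          by (rule sum_reorder5)
        also have "\<dots> = (\<Sum>a\<in>UNIV. \<Sum>m\<in>UNIV. \<Sum>n\<in>UNIV. (\<Sum>s\<in>UNIV. H z $ a $ s * cnj (v $ s)) *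
            (\<Sum>b\<in>UNIV. curv_tensor H a b m n z * v $ b) * v $ m * cnj (v $ n))"
          by (intro sum.cong refl, simp only: sum_product sum_distrib_right, intro sum.cong refl)
            (simp add: sum_distrib_left mult_ac)
        finally show ?thesis using curv[OF p]
          by (simp add: Gc_fibre_derivs(1)[OF p] delta_bar_chern_finsler[OF p] sum_negf)
      qed
      have "?S Q = ?S (\<lambda>b s m n. R_low b s m n z) - complex_of_real c / 4 *
         (?S (\<lambda>b s m n. H z $ b $ s * H z $ m $ n) + ?S (\<lambda>b s m n. H z $ b $ n * H z $ m $ s))"
        unfolding Q_def by (simp add: sum_distrib_left sum_subtractf sum.distrib algebra_simps)
      also have "\<dots> = 0" unfolding HH HH' using RR by (simp add: mult_ac)
      finally show ?thesis .
    qed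
  qed
  then show ?thesis by (simp add: Q_def)
qed

text \<open>In the trace, \<open>H\<^sub>\<mu>\<^sub>\<nu>\<close> is contracted with a Kronecker delta and contributes once, while \<open>H\<^sub>\<beta>\<^sub>\<nu>\<close> is
  multiplied by the trace of the identity: together \<open>n + 1\<close>.\<close>

lemma ricci_const_curv:
  assumes curv: "\<And>p. p \<in> \<Omega> \<Longrightarrow> - 2 * (\<Sum>\<alpha>\<in>UNIV. \<Sum>\<mu>\<in>UNIV. \<Sum>\<nu>\<in>UNIV.
      dv \<alpha> Gc p * delta_bar Gc \<nu> (chern_finsler Gc \<alpha> \<mu>) p * snd p $ \<mu> * cnj (snd p $ \<nu>))
        = complex_of_real c * (Gc p)\<^sup>2"
    and z: "z \<in> S"
  shows "ricci H \<beta> \<nu> z = complex_of_real (c * (CARD('n) + 1) / 4) * H z $ \<beta> $ \<nu>"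
proof -
  let ?I = "matrix_inv (H z)" let ?k = "complex_of_real c / 4"
  have up: "curv_tensor H \<alpha> \<beta> \<mu> \<nu> z = (\<Sum>\<sigma>\<in>UNIV. ?I $ \<sigma> $ \<alpha> * R_low \<beta> \<sigma> \<mu> \<nu> z)" for \<alpha> \<mu>
  proof -
    have "(\<Sum>\<sigma>\<in>UNIV. ?I $ \<sigma> $ \<alpha> * R_low \<beta> \<sigma> \<mu> \<nu> z)
        = (\<Sum>\<sigma>\<in>UNIV. \<Sum>\<gamma>\<in>UNIV. curv_tensor H \<gamma> \<beta> \<mu> \<nu> z * (H z $ \<gamma> $ \<sigma> * ?I $ \<sigma> $ \<alpha>))"
      by (simp add: R_low_def sum_distrib_left mult_ac)
    also have "\<dots> = (\<Sum>\<gamma>\<in>UNIV. curv_tensor H \<gamma> \<beta> \<mu> \<nu> z * (\<Sum>\<sigma>\<in>UNIV. H z $ \<gamma> $ \<sigma> * ?I $ \<sigma> $ \<alpha>))"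
      unfolding sum_distrib_left by (rule sum.swap)
    also have "\<dots> = curv_tensor H \<alpha> \<beta> \<mu> \<nu> z" by (simp add: H_inv(1)[OF z] if_distrib cong: if_cong)
    finally show ?thesis by simp
  qed
  have Rl: "R_low \<beta> \<sigma> \<mu> \<nu> z = ?k * (H z $ \<beta> $ \<sigma> * H z $ \<mu> $ \<nu> + H z $ \<beta> $ \<nu> * H z $ \<mu> $ \<sigma>)" for \<sigma> \<mu>
    by (rule R_low_const_curv[OF curv z])
  have "curv_tensor H \<mu> \<beta> \<mu> \<nu> z = ?k * ((if \<beta> = \<mu> then H z $ \<mu> $ \<nu> else 0) + H z $ \<beta> $ \<nu>)" for \<mu>
  proof -
    have "curv_tensor H \<mu> \<beta> \<mu> \<nu> z = ?k * (H z $ \<mu> $ \<nu> * (\<Sum>\<sigma>\<in>UNIV. H z $ \<beta> $ \<sigma> * ?I $ \<sigma> $ \<mu>)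
        + H z $ \<beta> $ \<nu> * (\<Sum>\<sigma>\<in>UNIV. H z $ \<mu> $ \<sigma> * ?I $ \<sigma> $ \<mu>))"
      unfolding up Rl
      by (simp add: sum_distrib_left sum.distrib[symmetric] algebra_simps)
    then show ?thesis by (simp add: H_inv(1)[OF z])
  qed
  then have "ricci H \<beta> \<nu> z = (\<Sum>\<mu>\<in>UNIV. ?k * ((if \<beta> = \<mu> then H z $ \<mu> $ \<nu> else 0) + H z $ \<beta> $ \<nu>))"
    by (simp only: ricci_def)
  also have "\<dots> = ?k * (H z $ \<beta> $ \<nu> + of_nat CARD('n) * H z $ \<beta> $ \<nu>)"
    unfolding sum_distrib_left[symmetric] by (simp add: sum.distrib)
  finally show ?thesis by (simp add: algebra_simps)
qed

end

section \<open>From the manifold to its charts\<close>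

lemma chart_props:
  assumes "complex_manifold M A" "c \<in> A"
  shows "fst c \<subseteq> topspace M" "open (snd c ` fst c)" "inj_on (snd c) (fst c)"
    and "openin M V \<Longrightarrow> open (snd c ` (fst c \<inter> V))"
    and "openin M (fst c)"
proof -
  obtain U \<phi> where c: "c = (U, \<phi>)" by (cases c)
  have U: "openin M U" "open (\<phi> ` U)" "homeomorphic_map (subtopology M U) (top_of_set (\<phi> ` U)) \<phi>"
    using assms unfolding complex_manifold_def c by auto
  show "fst c \<subseteq> topspace M" "open (snd c ` fst c)" "openin M (fst c)"
    using U openin_subset by (auto simp: c)
  then show "inj_on (snd c) (fst c)"
    using homeomorphic_imp_injective_map[OF U(3)] by (simp add: c topspace_subtopology Int_absorb1)
  assume "openin M V"
  then have "openin (subtopology M U) (U \<inter> V)"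
    by (simp add: openin_subtopology_Int2)
  then have "openin (top_of_set (\<phi> ` U)) (\<phi> ` (U \<inter> V))"
    using homeomorphic_imp_open_map[OF U(3)] by (simp add: open_map_def)
  then show "open (snd c ` (fst c \<inter> V))"
    using U(2) openin_open_trans by (simp add: c)
qed

lemma chart_inv_chart:
  assumes "complex_manifold M A" "c \<in> A" "p \<in> fst c"
  shows "chart_inv c (snd c p) = p"
  using chart_props(3)[OF assms(1,2)] assms(3) by (simp add: chart_inv_def)

lemma transition_derivative:
  assumes M: "complex_manifold M A" and cd: "c \<in> A" "d \<in> A" and p: "p \<in> fst c" "p \<in> fst d"
  shows "transition c d differentiable (at (snd c p))"
    and "ddir (a *s v) (transition c d) (snd c p) = a *s ddir v (transition c d) (snd c p)"
proof -
  have "holomorphic_map_on (snd c ` (fst c \<inter> fst d)) (transition c d)"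
    using M cd unfolding complex_manifold_def by blast
  then obtain f' where f': "(transition c d has_derivative f') (at (snd c p))" "Vector_Spaces.linear (*s) (*s) f'"
    using p unfolding holomorphic_map_on_def by blast
  show "transition c d differentiable (at (snd c p))" using f'(1) by (auto simp: differentiable_def)
  interpret Vector_Spaces.linear "(*s)" "(*s)" f' by (rule f'(2))
  show "ddir (a *s v) (transition c d) (snd c p) = a *s ddir v (transition c d) (snd c p)"
    unfolding ddir_eq[OF f'(1)] by (rule scale)
qed

text \<open>The chain rule for the cocycle identity of transition maps, which holds on the open image of the
  triple overlap.  It shows that a coordinate vector in one chart extends to a compatible family, that
  is, to a tangent vector.\<close>

lemma transition_cocycle:
  assumes M: "complex_manifold M A" and cd: "c \<in> A" "d \<in> A" "e \<in> A"
    and p: "p \<in> fst c" "p \<in> fst d" "p \<in> fst e"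
  shows "ddir v (transition c e) (snd c p) = ddir (ddir v (transition c d) (snd c p)) (transition d e) (snd d p)"
proof -
  let ?W = "snd c ` (fst c \<inter> (fst d \<inter> fst e))"
  have "open ?W"
    using chart_props(4)[OF M cd(1)] chart_props(5)[OF M] cd by blast
  moreover have "snd c p \<in> ?W" using p by blast
  moreover have "transition c e z = (transition d e \<circ> transition c d) z" if zW: "z \<in> ?W" for z
  proof -
    obtain q where q: "z = snd c q" "q \<in> fst c" "q \<in> fst d" "q \<in> fst e" using zW by blast
    then show ?thesis
      using chart_inv_chart[OF M cd(1)] chart_inv_chart[OF M cd(2)] by (simp add: transition_def)
  qed
  ultimately have "ddir v (transition c e) (snd c p) = ddir v (transition d e \<circ> transition c d) (snd c p)"
    by (rule ddir_cong)
  also have "\<dots> = ddir (ddir v (transition c d) (snd c p)) (transition d e) (snd d p)"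
  proof -
    have "transition c d (snd c p) = snd d p"
      using chart_inv_chart[OF M cd(1) p(1)] by (simp add: transition_def)
    then show ?thesis
      using diff_chain_at[OF transition_derivative(1)[OF M cd(1,2) p(1,2), unfolded frechet_derivative_works], of "transition d e"]
        transition_derivative(1)[OF M cd(2,3) p(2,3), unfolded frechet_derivative_works]
      by (intro ddir_eq[THEN trans]) (auto simp: comp_def)
  qed
  finally show ?thesis .
qed

text \<open>Homogeneity of \<open>F\<close> is a statement about compatible families of coordinate vectors.  It descends to a
  chart because derivatives of holomorphic transition maps are complex linear.\<close>

lemma in_chart_scale:
  assumes M: "complex_manifold M A" and F: "strongly_convex_complex_finsler M A F"
    and c: "c \<in> A" and z: "z \<in> snd c ` fst c"
  shows "in_chart A c F (z, a *s v) = cmod a * in_chart A c F (z, v)"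
proof -
  obtain p where p: "p \<in> fst c" "z = snd c p" using z by blast
  have ci: "chart_inv c z = p" using chart_inv_chart[OF M c p(1)] p(2) by simp
  define t where "t v = (\<lambda>d. if d \<in> A \<and> p \<in> fst d then ddir v (transition c d) z else 0)" for v
  have tp: "tangent_point A c (z, v) = (p, t v)" for v
    by (simp add: tangent_point_def ci t_def)
  have "t v \<in> hol_tangent_space A p"
    unfolding hol_tangent_space_def
  proof (intro CollectI conjI ballI allI impI)
    fix d e assume "d \<in> A" "e \<in> A" "p \<in> fst d" "p \<in> fst e"
    then show "t v e = ddir (t v d) (transition d e) (snd d p)"
      using transition_cocycle[OF M c \<open>d \<in> A\<close> \<open>e \<in> A\<close> p(1), of v] by (simp add: t_def p(2))
  qed (auto simp: t_def)
  then have "(p, t v) \<in> hol_tangent_bundle M A"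
    using p(1) chart_props(1)[OF M c] by (auto simp: hol_tangent_bundle_def)
  then have "F (p, \<lambda>d. a *s t v d) = cmod a * F (p, t v)"
    using F unfolding strongly_convex_complex_finsler_def by blast
  moreover have "t (a *s v) = (\<lambda>d. a *s t v d)"
    using transition_derivative(2)[OF M c _ p(1), of _ a v] by (auto simp: t_def p(2))
  ultimately show ?thesis by (simp add: in_chart_def tp)
qed

lemma finsler_chart_of_manifold:
  fixes A :: "('a, 'b::finite) chart set"
  assumes M: "complex_manifold M A" and F: "strongly_convex_complex_finsler M A F"
    and J: "cartan_J_parallel A F" and c: "c \<in> A"
  shows "finsler_chart (snd c ` fst c) (in_chart A c (\<lambda>\<xi>. (F \<xi>)\<^sup>2))"
proof
  show S: "open (snd c ` fst c)" by (rule chart_props(2)[OF M c])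
  have sd: "slit_dom c = (snd c ` fst c) \<times> (UNIV - {0})" by (simp add: slit_dom_def)
  have open_sd: "open (slit_dom c)" unfolding sd by (intro open_Times S) auto
  have G: "in_chart A c (\<lambda>\<xi>. (F \<xi>)\<^sup>2) = (\<lambda>q. in_chart A c F q * in_chart A c F q)"
    by (rule ext) (simp add: in_chart_def power2_eq_square)
  have "smooth_on (slit_dom c) (in_chart A c F)"
    using F c unfolding strongly_convex_complex_finsler_def by blast
  then show "smooth_on (snd c ` fst c \<times> (UNIV - {0})) (in_chart A c (\<lambda>\<xi>. (F \<xi>)\<^sup>2))"
    unfolding G sd[symmetric] by (intro smooth_on_bilinear[OF open_sd bounded_bilinear_mult])
  show "in_chart A c (\<lambda>\<xi>. (F \<xi>)\<^sup>2) (z, a *s v) = (cmod a)\<^sup>2 * in_chart A c (\<lambda>\<xi>. (F \<xi>)\<^sup>2) (z, v)"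
    if "z \<in> snd c ` fst c" for z v a
    unfolding G in_chart_scale[OF M F c that] by (simp add: power2_eq_square)
  fix p :: "(complex^'b) \<times> (complex^'b)" assume p: "p \<in> snd c ` fst c \<times> (UNIV - {0})"
  show "0 < \<xi> \<bullet> (fund_tensor (in_chart A c (\<lambda>\<xi>. (F \<xi>)\<^sup>2)) p *v \<xi>)" if "\<xi> \<noteq> 0" for \<xi>
    using F c p that unfolding strongly_convex_complex_finsler_def sd[symmetric] by blast
  fix X a
  show "cartan_nabla (in_chart A c (\<lambda>\<xi>. (F \<xi>)\<^sup>2)) p X (\<lambda>_. vert_J a) =
       vert_J (cartan_nabla (in_chart A c (\<lambda>\<xi>. (F \<xi>)\<^sup>2)) p X (\<lambda>_. a))"
    using J[unfolded cartan_J_parallel_def Let_def, rule_format, OF c open_sd order_refl smooth_on_const[of "slit_dom c" a]] p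
    unfolding sd by blast
qed

theorem theorem1p6:
  fixes M :: "'a topology"
    and A :: "('a, 'n::finite) chart set"
    and F :: "'a \<times> (('a, 'n) chart \<Rightarrow> complex^'n) \<Rightarrow> real"
    and c :: real
  assumes "CARD('n) \<ge> 2"
    and "complex_manifold M A"
    and "strongly_convex_complex_finsler M A F"
    and "cartan_J_parallel A F"
    and "constant_hol_sect_curv A F c"
    and "c \<noteq> 0"
  shows "kaehler_einstein A F"
  unfolding kaehler_einstein_def
proof (intro exI ballI)
  fix d assume d: "d \<in> A"
  define S where "S = snd d ` fst d"
  define G where "G = in_chart A d (\<lambda>\<xi>. (F \<xi>)\<^sup>2)"
  interpret finsler_chart S G
    unfolding S_def G_def by (rule finsler_chart_of_manifold[OF assms(2,3,4) d])
  have Gc_eq: "in_chart A d (\<lambda>\<xi>. complex_of_real ((F \<xi>)\<^sup>2)) = Gc"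
    by (rule ext) (simp add: G_def in_chart_def)
  have curv: "- 2 * (\<Sum>\<alpha>\<in>UNIV. \<Sum>\<mu>\<in>UNIV. \<Sum>\<nu>\<in>UNIV.
      dv \<alpha> Gc p * delta_bar Gc \<nu> (chern_finsler Gc \<alpha> \<mu>) p * snd p $ \<mu> * cnj (snd p $ \<nu>))
        = complex_of_real c * (Gc p)\<^sup>2" if "p \<in> \<Omega>" for p
  proof -
    obtain z v where p: "p = (z, v)" by (cases p)
    then have "(z, v) \<in> S \<times> (UNIV - {0})" using that by (simp add: \<Omega>_def)
    then have "(z, v) \<in> slit_dom d" by (simp add: slit_dom_def S_def)
    then show ?thesis
      using assms(5)[unfolded constant_hol_sect_curv_def Let_def, rule_format, OF d, of "(z, v)", unfolded Gc_eq]
      by (simp add: p)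
  qed
  show "kaehler_on (snd d ` fst d) H \<and>
      (\<forall>z\<in>snd d ` fst d. \<forall>v. complex_of_real ((in_chart A d F (z, v))\<^sup>2) =
        (\<Sum>\<mu>\<in>UNIV. \<Sum>\<nu>\<in>UNIV. H z $ \<mu> $ \<nu> * v $ \<mu> * cnj (v $ \<nu>))) \<and>
      (\<forall>z\<in>snd d ` fst d. \<forall>\<mu> \<nu>.
        ricci H \<mu> \<nu> z = complex_of_real (c * (real CARD('n) + 1) / 4) * H z $ \<mu> $ \<nu>)"
    unfolding S_def[symmetric]
  proof (intro conjI ballI allI)
    show "kaehler_on S H" by (rule kaehler)
    fix z assume z: "z \<in> S"
    show "complex_of_real ((in_chart A d F (z, v))\<^sup>2) = (\<Sum>\<mu>\<in>UNIV. \<Sum>\<nu>\<in>UNIV. H z $ \<mu> $ \<nu> * v $ \<mu> * cnj (v $ \<nu>))" for v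
      using G_hform[OF z, of v] unfolding hform_H[OF z] by (simp add: G_def in_chart_def)
    show "ricci H \<mu> \<nu> z = complex_of_real (c * (real CARD('n) + 1) / 4) * H z $ \<mu> $ \<nu>" for \<mu> \<nu>
      using ricci_const_curv[OF curv z] by simp
  qed
qed

end
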